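(* Let $H$ be a Hopf algebra over a field $\Bbbk$ with $S_H(H_{[0]})\subseteq H_{[0]}$, and let $O$, $X$, $\pi:\Bbbk\langle X\rangle\to H$, $I=\ker\pi$, with the orders $<_O,<_X,<_{\langle X\rangle}$, be as in the framework described in the context. If $x$ is an $I$-reducible letter in $X_+$, then $x$ is congruent modulo $I$ to a finite linear combination of words, $$x\in\sum k_{x_1\cdots x_n}\,x_1\cdots x_n+I,\qquad k_{x_1\cdots x_n}\in\Bbbk,$$ where in each word all letters $x_1,\dots,x_n$ lie in $X_{I,+}\cup X_0$ and satisfy $x_1,\dots,x_n<_Xx$. Consequently, every non-empty word in $\langle X\rangle$ can be expressed modulo $I$ as a linear combination of products of letters from $X_{I,+}\cup X_0$, or more precisely, from $O_{I,+}\cup X_0$.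
   Context: Words. For a set $Z$, $\langle Z\rangle$ is the free monoid on $Z$ (empty word $1$), $\langle Z\rangle^+$ the set of non-empty words, $\Bbbk\langle Z\rangle$ the free algebra, $\Bbbk\langle Z\rangle^+$ the span of $\langle Z\rangle^+$, $\Bbbk Z$ the span of $Z$, $Z^*=Z\cup\{1\}$. For a non-empty word $\alpha$, $|\alpha|$ is its length and $r(\alpha)$ its last letter. For a totally ordered set $(Z,<_Z)$ the mirror lexicographic order on $\langle Z\rangle$ is: $\alpha<_{\mathrm{mlex}_Z}\beta$ iff $\alpha$ is a proper suffix of $\beta$, or $\alpha=\eta x\gamma$, $\beta=\zeta y\gamma$ with $x,y\in Z$, $x<_Z y$ and words $\gamma,\eta,\zeta$. Sets and orders. $O$ is a set with a map $t_O:O\to\mathbb N$ and a well order $<_O$; $O_n=t_O^{-1}(n)$, $O_+=\{y: t_O(y)\ge1\}$. For $y\in O_+$ put $y_1=y$ and let $C_y=\{y_a\mid a\in O_0^*\}$ be pairwise disjoint sets of formal symbols; $X=O_0\cup\bigcup_{y\in O_+}C_y\supseteq O$. Define $C:X\to O$ by $C(a)=a$ ($a\in O_0$), $C(y_a)=y$ ($y\in O_+$, $a\in O_0^*$), extended to a monoid map $C:\langle X\rangle\to\langle O\rangle$; put $t_X(x)=t_O(C(x))$, $X_0=t_X^{-1}(0)=O_0$, $X_+=\{x:t_X(x)\ge1\}$. On $C_z$: $z<_{C_z}z_a$ for $a\in O_0$, and $z_b<_{C_z}z_c$ iff $b<_O c$. On $X$: $x<_Xy$ iff $C(x)<_OC(y)$,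 or $C(x)=C(y)=z\in O_+$ and $x<_{C_z}y$. On $\langle O\rangle$: $1<_{\langle O\rangle}\alpha$ for non-empty $\alpha$; for non-empty $\alpha,\beta$, $\alpha<_{\langle O\rangle}\beta$ iff $r(\alpha)<_Or(\beta)$, or $r(\alpha)=r(\beta)$ and ($|\alpha|<|\beta|$, or $|\alpha|=|\beta|$ and $\alpha<_{\mathrm{mlex}_O}\beta$). On $\langle X\rangle$: $\alpha<_{\langle X\rangle}\beta$ iff $C(\alpha)<_{\langle O\rangle}C(\beta)$, or $C(\alpha)=C(\beta)$ and $\alpha<_{\mathrm{mlex}_X}\beta$. All these orders except mlex are well orders. Irreducibility. For a non-zero $f\in\Bbbk\langle X\rangle$, $\mathrm{LW}(f)$ is the $<_{\langle X\rangle}$-greatest word in the support of $f$. For an ideal $I$, a word is $I$-reducible if it equals $\mathrm{LW}(f)$ for some non-zero $f\in I$, and $I$-irreducible otherwise. $X_{I,+}=\{x\in X_+\mid x\text{ is }I\text{-irreducible}\}$, $O_{I,+}=X_{I,+}\cap O$. Framework. $H$ is a Hopf algebra over $\Bbbk$ with coradical $H_{(0)}$ (sum of simple subcoalgebras), Hopf coradical $H_{[0]}$ (subalgebra generated by $H_{(0)}$), $S_H(H_{[0]})\subseteq H_{[0]}$, and standard filtration $H_{[n]}=\bigwedge^{n+1}H_{[0]}$, i.e. $H_{[n]}=\Delta_H^{-1}(H_{[n-1]}\otimes H+H\otimes H_{[0]})$ for $n\ge1$. The set $O$ generates $H$ via a map $f_O:O\to\ker\epsilon_H$, $t_O(y)=\min\{n\mid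 f_O(y)\in H_{[n]}\}$, and $f_O$ maps $O_0$ bijectively onto a basis of $\ker\epsilon_{H_{[0]}}$. The order $<_O$ is degree-first: each $O_n$ has a well order $<_{O_n}$, and $x<_Oy$ iff $t_O(x)<t_O(y)$, or $t_O(x)=t_O(y)=n$ and $x<_{O_n}y$. The map $f_X:X\to H$ is given by $f_X|_O=f_O$ and $f_X(y_a)=\sum f_O(a)_{(1)}f_O(y)S_H(f_O(a)_{(2)})$ for $y\in O_+$, $a\in O_0$; $\pi:\Bbbk\langle X\rangle\to H$ is the (surjective) algebra map extending $f_X$; $I=\ker\pi$; $\epsilon=\epsilon_H\circ\pi$, so $X,I\subseteq\ker\epsilon$. There is an algebra map $\Delta:\Bbbk\langle X\rangle\to\Bbbk\langle X\rangle\otimes\Bbbk\langle X\rangle$ with $\Delta_H\circ\pi=(\pi\otimes\pi)\circ\Delta$ (so $\Delta(I)\subseteq I\otimes\Bbbk\langle X\rangle+\Bbbk\langle X\rangle\otimes I$) which is skew-triangular: for each $x\in X_0$, $\Delta(x)=x\otimes(1-r_x)+1\otimes x+\sum x'\otimes x''$ (finite sum) with $x'\in X_0$, $x'\ne x$, $r_x,x''\in\Bbbk X_0$; for each $x\in X_+$, $\Delta(x)=x\otimes1+1\otimes x+\sum x'_+x'_0\otimes x''$ (finite sum) with $x'_+\in X_+^*$, $x'_0\in X_0^*$, $x'_+x'_0\neq1$, $x''\in\Bbbk\langle X\rangle^+$, $t_X(x'_+)<t_X(x)$ and $C(x'_+)<_OC(x)$ (the last two conditions being regarded as satisfied when $x'_+=1$).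 Such data exist for every such $H$. *)

theory Defs
  imports Complex_Main "HOL-Library.Poly_Mapping" "HOL-Library.Product_Plus"
begin

section \<open>Free vector spaces and free algebras\<close>

text \<open>
  Words are lists, made into the additive monoid of concatenation. With this, the monoid algebra
  \<open>'x list \<Rightarrow>\<^sub>0 'k\<close> of the library is the free algebra on \<open>'x\<close>, its unit being the empty word.
\<close>

instantiation list :: (type) monoid_add
begin

definition zero_list :: "'a list" where "zero_list = []"

definition plus_list :: "'a list \<Rightarrow> 'a list \<Rightarrow> 'a list" where "plus_list u v = u @ v"

instance by standard (simp_all add: zero_list_def plus_list_def)

end

definition fscale :: "'k::field \<Rightarrow> ('a \<Rightarrow>\<^sub>0 'k) \<Rightarrow> ('a \<Rightarrow>\<^sub>0 'k)" where
  "fscale c p = Poly_Mapping.map ((*) c) p"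

lemma lookup_fscale [simp]: "Poly_Mapping.lookup (fscale c p) a = c * Poly_Mapping.lookup p a"
  by (simp add: fscale_def map.rep_eq when_def)

interpretation fscale: vector_space fscale
  by standard (auto intro!: poly_mapping_eqI simp: lookup_add algebra_simps)

text \<open>\<open>lin_ext s g\<close> is the linear map out of the free vector space on \<open>'a\<close> that extends \<open>g\<close>;
  \<open>s\<close> is the scalar multiplication of the target.\<close>

definition lin_ext :: "('k::field \<Rightarrow> 'c::ab_group_add \<Rightarrow> 'c) \<Rightarrow> ('a \<Rightarrow> 'c) \<Rightarrow> ('a \<Rightarrow>\<^sub>0 'k) \<Rightarrow> 'c" where
  "lin_ext s g p = (\<Sum>a\<in>Poly_Mapping.keys p. s (Poly_Mapping.lookup p a) (g a))"

definition free_algebra :: "'x set \<Rightarrow> ('x list \<Rightarrow>\<^sub>0 'k::field) set" where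
  "free_algebra Z = {p. Poly_Mapping.keys p \<subseteq> lists Z}"

definition free_algebra_plus :: "'x set \<Rightarrow> ('x list \<Rightarrow>\<^sub>0 'k::field) set" where
  "free_algebra_plus Z = {p. Poly_Mapping.keys p \<subseteq> lists Z - {[]}}"

definition letter_span :: "'x set \<Rightarrow> ('x list \<Rightarrow>\<^sub>0 'k::field) set" where
  "letter_span Z = {p. Poly_Mapping.keys p \<subseteq> (\<lambda>z. [z]) ` Z}"

definition free_alg_hom ::
    "('k::field \<Rightarrow> 'h::ring_1 \<Rightarrow> 'h) \<Rightarrow> ('x \<Rightarrow> 'h) \<Rightarrow> ('x list \<Rightarrow>\<^sub>0 'k) \<Rightarrow> 'h" where
  "free_alg_hom s g = lin_ext s (\<lambda>w. prod_list (map g w))"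


section \<open>Tensor products\<close>

text \<open>
  The tensor product of two vector spaces is the free vector space \<open>'a \<times> 'b \<Rightarrow>\<^sub>0 'k\<close> on pairs
  modulo the subspace \<open>tensor_null\<close> spanned by the bilinearity relations. As scalar
  multiplications are terms and not type class operations, the quotient cannot be a type;
  its elements are represented by formal sums, which are compared by \<open>tensor_eq\<close>.
\<close>

definition tensor_null ::
    "('k::field \<Rightarrow> 'a::ab_group_add \<Rightarrow> 'a) \<Rightarrow> ('k \<Rightarrow> 'b::ab_group_add \<Rightarrow> 'b) \<Rightarrow> ('a \<times> 'b \<Rightarrow>\<^sub>0 'k) set" where
  "tensor_null s1 s2 = fscale.span
    ({Poly_Mapping.single (a + a', b) 1 - Poly_Mapping.single (a, b) 1 - Poly_Mapping.single (a', b) 1 | a a' b. True}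
   \<union> {Poly_Mapping.single (a, b + b') 1 - Poly_Mapping.single (a, b) 1 - Poly_Mapping.single (a, b') 1 | a b b'. True}
   \<union> {Poly_Mapping.single (s1 c a, b) 1 - Poly_Mapping.single (a, b) c | c a b. True}
   \<union> {Poly_Mapping.single (a, s2 c b) 1 - Poly_Mapping.single (a, b) c | c a b. True})"

definition tensor_eq ::
    "('k::field \<Rightarrow> 'a::ab_group_add \<Rightarrow> 'a) \<Rightarrow> ('k \<Rightarrow> 'b::ab_group_add \<Rightarrow> 'b)
      \<Rightarrow> ('a \<times> 'b \<Rightarrow>\<^sub>0 'k) \<Rightarrow> ('a \<times> 'b \<Rightarrow>\<^sub>0 'k) \<Rightarrow> bool" where
  "tensor_eq s1 s2 T T' \<longleftrightarrow> T - T' \<in> tensor_null s1 s2"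

definition tensor3_null ::
    "('k::field \<Rightarrow> 'a::ab_group_add \<Rightarrow> 'a) \<Rightarrow> ('a \<times> 'a \<times> 'a \<Rightarrow>\<^sub>0 'k) set" where
  "tensor3_null s = fscale.span
    ({Poly_Mapping.single (a + a', b, c) 1 - Poly_Mapping.single (a, b, c) 1 - Poly_Mapping.single (a', b, c) 1 | a a' b c. True}
   \<union> {Poly_Mapping.single (a, b + b', c) 1 - Poly_Mapping.single (a, b, c) 1 - Poly_Mapping.single (a, b', c) 1 | a b b' c. True}
   \<union> {Poly_Mapping.single (a, b, c + c') 1 - Poly_Mapping.single (a, b, c) 1 - Poly_Mapping.single (a, b, c') 1 | a b c c'. True}
   \<union> {Poly_Mapping.single (s k a, b, c) 1 - Poly_Mapping.single (a, b, c) k | k a b c. True}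
   \<union> {Poly_Mapping.single (a, s k b, c) 1 - Poly_Mapping.single (a, b, c) k | k a b c. True}
   \<union> {Poly_Mapping.single (a, b, s k c) 1 - Poly_Mapping.single (a, b, c) k | k a b c. True})"

text \<open>The subspace \<open>U \<otimes> W\<close> of the tensor product of the ambient spaces, for subspaces \<open>U\<close>, \<open>W\<close>.\<close>

definition tensor_sub ::
    "('k::field \<Rightarrow> 'a::ab_group_add \<Rightarrow> 'a) \<Rightarrow> ('k \<Rightarrow> 'b::ab_group_add \<Rightarrow> 'b)
      \<Rightarrow> 'a set \<Rightarrow> 'b set \<Rightarrow> ('a \<times> 'b \<Rightarrow>\<^sub>0 'k) set" where
  "tensor_sub s1 s2 U W = {T. \<exists>T'. Poly_Mapping.keys T' \<subseteq> U \<times> W \<and> tensor_eq s1 s2 T T'}"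

definition tensor_mult ::
    "('a::ring_1 \<times> 'b::ring_1 \<Rightarrow>\<^sub>0 'k::field) \<Rightarrow> ('a \<times> 'b \<Rightarrow>\<^sub>0 'k) \<Rightarrow> ('a \<times> 'b \<Rightarrow>\<^sub>0 'k)" where
  "tensor_mult T T' =
    lin_ext fscale (\<lambda>(a, b). lin_ext fscale (\<lambda>(c, d). Poly_Mapping.single (a * c, b * d) 1) T') T"

text \<open>
  For free algebras the tensor product has the pairs of words as a basis, so the algebra
  \<open>\<k>\<langle>X\<rangle> \<otimes> \<k>\<langle>X\<rangle>\<close> is taken to be the monoid algebra of the product monoid, where
  equality is proper equality; \<open>free_tensor p q\<close> is the element \<open>p \<otimes> q\<close>. The lemma
  \<open>tensor_eq_free_iff\<close> below shows that this agrees with the construction above.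
\<close>

definition free_tensor ::
    "('x list \<Rightarrow>\<^sub>0 'k::field) \<Rightarrow> ('y list \<Rightarrow>\<^sub>0 'k) \<Rightarrow> ('x list \<times> 'y list \<Rightarrow>\<^sub>0 'k)" where
  "free_tensor p q = (\<Sum>u\<in>Poly_Mapping.keys p. \<Sum>v\<in>Poly_Mapping.keys q. Poly_Mapping.single (u, v) (Poly_Mapping.lookup p u * Poly_Mapping.lookup q v))"

definition free_tensor_algebra :: "'x set \<Rightarrow> ('x list \<times> 'x list \<Rightarrow>\<^sub>0 'k::field) set" where
  "free_tensor_algebra Z = {T. Poly_Mapping.keys T \<subseteq> lists Z \<times> lists Z}"

lemma lookup_free_tensor [simp]: "Poly_Mapping.lookup (free_tensor p q) (u, v) = Poly_Mapping.lookup p u * Poly_Mapping.lookup q v"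
proof -
  have "Poly_Mapping.lookup (free_tensor p q) (u, v) =
      (\<Sum>u'\<in>Poly_Mapping.keys p. \<Sum>v'\<in>Poly_Mapping.keys q. if u' = u then (if v' = v then Poly_Mapping.lookup p u' * Poly_Mapping.lookup q v' else 0) else 0)"
    unfolding free_tensor_def lookup_sum
    by (intro sum.cong refl) (auto simp: lookup_single when_def)
  also have "\<dots> = (\<Sum>u'\<in>Poly_Mapping.keys p. if u' = u then (\<Sum>v'\<in>Poly_Mapping.keys q. if v' = v then Poly_Mapping.lookup p u' * Poly_Mapping.lookup q v' else 0) else 0)"
    by (intro sum.cong refl) auto
  also have "\<dots> = Poly_Mapping.lookup p u * Poly_Mapping.lookup q v"
    by (auto simp: sum.delta in_keys_iff)
  finally show ?thesis .
qed

lemma lin_ext_superset: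
  assumes "vector_space s" "finite A" "Poly_Mapping.keys p \<subseteq> A"
  shows "lin_ext s g p = (\<Sum>a\<in>A. s (Poly_Mapping.lookup p a) (g a))"
proof -
  interpret vector_space s by fact
  show ?thesis
    unfolding lin_ext_def using assms(2,3)
    by (intro sum.mono_neutral_left) (auto simp: in_keys_iff)
qed

lemma lin_ext_add:
  assumes "vector_space s"
  shows "lin_ext s g (p + q) = lin_ext s g p + lin_ext s g q"
proof -
  interpret vector_space s by fact
  let ?A = "Poly_Mapping.keys p \<union> Poly_Mapping.keys q"
  have "lin_ext s g r = (\<Sum>a\<in>?A. s (Poly_Mapping.lookup r a) (g a))" if "r \<in> {p, q, p + q}" for r
    using that keys_add[of p q] by (intro lin_ext_superset[OF assms]) auto
  then show ?thesis
    by (simp add: lookup_add scale_left_distrib sum.distrib)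
qed

lemma lin_ext_scale:
  assumes "vector_space s"
  shows "lin_ext s g (fscale c p) = s c (lin_ext s g p)"
proof -
  interpret vector_space s by fact
  have "Poly_Mapping.keys (fscale c p) \<subseteq> Poly_Mapping.keys p"
    by (auto simp: in_keys_iff)
  then have "lin_ext s g (fscale c p) = (\<Sum>a\<in>Poly_Mapping.keys p. s (Poly_Mapping.lookup (fscale c p) a) (g a))"
    by (intro lin_ext_superset[OF assms]) auto
  then show ?thesis
    by (simp add: lin_ext_def scale_sum_right)
qed

lemma lin_ext_single:
  assumes "vector_space s"
  shows "lin_ext s g (Poly_Mapping.single a c) = s c (g a)"
proof -
  interpret vector_space s by fact
  show ?thesis by (simp add: lin_ext_def)
qed

lemma lin_ext_diff:
  assumes "vector_space s"
  shows "lin_ext s g (p - q) = lin_ext s g p - lin_ext s g q"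
  using lin_ext_add[OF assms, of g "p - q" q] by (simp add: algebra_simps)

lemma fscale_single: "fscale c (Poly_Mapping.single a d) = Poly_Mapping.single a (c * d)"
  by (intro poly_mapping_eqI) (simp add: lookup_single when_def)

lemma fscale_expand: "p = (\<Sum>a\<in>Poly_Mapping.keys p. fscale (Poly_Mapping.lookup p a) (Poly_Mapping.single a 1))"
  by (intro poly_mapping_eqI)
     (auto simp: lookup_sum lookup_single when_def in_keys_iff if_distrib sum.delta cong: if_cong)

theorem tensor_eq_free_iff:
  fixes T T' :: "(('x list \<Rightarrow>\<^sub>0 'k::field) \<times> ('y list \<Rightarrow>\<^sub>0 'k)) \<Rightarrow>\<^sub>0 'k"
  shows "tensor_eq fscale fscale T T' \<longleftrightarrow>
    lin_ext fscale (\<lambda>(p, q). free_tensor p q) T = lin_ext fscale (\<lambda>(p, q). free_tensor p q) T'"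
proof -
  note vs = fscale.vector_space_axioms
  let ?N = "tensor_null fscale fscale :: ((('x list \<Rightarrow>\<^sub>0 'k) \<times> ('y list \<Rightarrow>\<^sub>0 'k)) \<Rightarrow>\<^sub>0 'k) set"
  define L :: "((('x list \<Rightarrow>\<^sub>0 'k) \<times> ('y list \<Rightarrow>\<^sub>0 'k)) \<Rightarrow>\<^sub>0 'k) \<Rightarrow> _"
    where "L = lin_ext fscale (\<lambda>(p, q). free_tensor p q)"
  define E :: "('x list \<times> 'y list \<Rightarrow>\<^sub>0 'k) \<Rightarrow> _"
    where "E = lin_ext fscale (\<lambda>(u, v). Poly_Mapping.single
      (Poly_Mapping.single u (1::'k), Poly_Mapping.single v (1::'k)) (1::'k))"
  note Ls = lin_ext_add[OF vs] lin_ext_diff[OF vs] lin_ext_scale[OF vs] lin_ext_single[OF vs]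
  have sub: "fscale.subspace ?N"
    unfolding tensor_null_def by (rule fscale.subspace_span)
  have rel1: "Poly_Mapping.single (a + a', b) 1 - Poly_Mapping.single (a, b) 1 - Poly_Mapping.single (a', b) 1 \<in> ?N"
    and rel2: "Poly_Mapping.single (a, b + b') 1 - Poly_Mapping.single (a, b) 1 - Poly_Mapping.single (a, b') 1 \<in> ?N"
    and rel3: "Poly_Mapping.single (fscale c a, b) 1 - Poly_Mapping.single (a, b) c \<in> ?N"
    and rel4: "Poly_Mapping.single (a, fscale c b) 1 - Poly_Mapping.single (a, b) c \<in> ?N" for a a' b b' c
    unfolding tensor_null_def by (rule fscale.span_base, blast)+
  have ft_add: "free_tensor (p + p') q = free_tensor p q + free_tensor p' q"
      "free_tensor p (q + q') = free_tensor p q + free_tensor p q'"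
      "free_tensor (fscale c p) q = fscale c (free_tensor p q)"
      "free_tensor p (fscale c q) = fscale c (free_tensor p q)"
      "free_tensor 0 q = 0" "free_tensor p 0 = 0"
    for p p' :: "'x list \<Rightarrow>\<^sub>0 'k" and q q' :: "'y list \<Rightarrow>\<^sub>0 'k" and c
    by (auto intro!: poly_mapping_eqI simp: lookup_add algebra_simps)
  have zero: "L R = 0" if "R \<in> ?N" for R
    using that unfolding tensor_null_def
  proof (induction rule: fscale.span_induct_alt)
    case base
    show ?case by (simp add: L_def lin_ext_def)
  next
    case (step c R R')
    have "L R = 0"
      using step(1) unfolding L_def by (elim UnE CollectE exE conjE) (simp_all add: Ls ft_add)
    then show ?case using step(2) by (simp add: L_def Ls)
  qed
  have ind: "p \<in> P" if "fscale.subspace P" "\<And>a. Poly_Mapping.single a 1 \<in> P" for P and p :: "'c \<Rightarrow>\<^sub>0 'k"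
    by (subst fscale_expand) (intro fscale.subspace_sum fscale.subspace_scale that)
  have lin: "fscale.subspace {R. R - E (L R) \<in> ?N}"
  proof (rule fscale.subspaceI)
    show "0 \<in> {R. R - E (L R) \<in> ?N}"
      using fscale.subspace_0[OF sub] by (simp add: L_def E_def lin_ext_def)
  next
    fix R R' assume "R \<in> {R. R - E (L R) \<in> ?N}" "R' \<in> {R. R - E (L R) \<in> ?N}"
    then have "(R - E (L R)) + (R' - E (L R')) \<in> ?N"
      by (intro fscale.subspace_add[OF sub]) auto
    then show "R + R' \<in> {R. R - E (L R) \<in> ?N}"
      by (simp add: L_def E_def Ls algebra_simps)
  next
    fix c R assume "R \<in> {R. R - E (L R) \<in> ?N}"
    then have "fscale c (R - E (L R)) \<in> ?N"
      by (intro fscale.subspace_scale[OF sub]) auto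
    then show "fscale c R \<in> {R. R - E (L R) \<in> ?N}"
      by (simp add: L_def E_def Ls fscale.scale_right_diff_distrib)
  qed
  have ft_single: "free_tensor (Poly_Mapping.single u 1) (Poly_Mapping.single v 1) = Poly_Mapping.single (u, v) (1::'k)"
    for u :: "'x list" and v :: "'y list"
    by (intro poly_mapping_eqI) (auto simp: lookup_single when_def split: if_splits)
  define D where "D p q = Poly_Mapping.single (p, q) 1 - E (free_tensor p q)" for p q
  have D_add1: "D (p + p') q - D p q - D p' q \<in> ?N" for p p' q
    using rel1[of p p' q] by (simp add: D_def E_def ft_add Ls algebra_simps)
  have D_add2: "D p (q + q') - D p q - D p q' \<in> ?N" for p q q'
    using rel2[of p q q'] by (simp add: D_def E_def ft_add Ls algebra_simps)
  have D_sc1: "D (fscale c p) q - fscale c (D p q) \<in> ?N" for p q c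
    using rel3[of c p q]
    by (simp add: D_def E_def ft_add Ls fscale.scale_right_diff_distrib fscale_single)
  have D_sc2: "D p (fscale c q) - fscale c (D p q) \<in> ?N" for p q c
    using rel4[of p c q]
    by (simp add: D_def E_def ft_add Ls fscale.scale_right_diff_distrib fscale_single)
  have mem: "x \<in> ?N" if "x - y - z \<in> ?N" "y \<in> ?N" "z \<in> ?N" for x y z
    using fscale.subspace_add[OF sub fscale.subspace_add[OF sub that(1) that(2)] that(3)] by simp
  have mem': "x \<in> ?N" if "x - y \<in> ?N" "y \<in> ?N" for x y
    using fscale.subspace_add[OF sub that] by simp
  have D00: "D 0 q \<in> ?N" "D p 0 \<in> ?N" for p q
    using D_sc1[of 0 0 q] D_sc2[of p 0 0] by simp_all
  have D1: "D (Poly_Mapping.single u 1) (Poly_Mapping.single v 1) \<in> ?N" for u v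
    using fscale.subspace_0[OF sub] by (simp add: D_def E_def ft_single Ls)
  have D2: "p \<in> {p. D p (Poly_Mapping.single v 1) \<in> ?N}" for p v
  proof (rule ind)
    show "fscale.subspace {p. D p (Poly_Mapping.single v 1) \<in> ?N}"
      by (rule fscale.subspaceI)
         (auto intro: D00 mem[OF D_add1] mem'[OF D_sc1] fscale.subspace_scale[OF sub])
  qed (simp add: D1)
  have D3: "q \<in> {q. D p q \<in> ?N}" for p q
  proof (rule ind)
    show "fscale.subspace {q. D p q \<in> ?N}"
      by (rule fscale.subspaceI)
         (auto intro: D00 mem[OF D_add2] mem'[OF D_sc2] fscale.subspace_scale[OF sub])
  qed (use D2 in simp)
  have red: "R \<in> {R. R - E (L R) \<in> ?N}" for R
  proof (rule ind[OF lin])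
    fix a :: "('x list \<Rightarrow>\<^sub>0 'k) \<times> ('y list \<Rightarrow>\<^sub>0 'k)"
    show "Poly_Mapping.single a 1 \<in> {R. R - E (L R) \<in> ?N}"
      using D3[of "snd a" "fst a"] by (cases a) (simp add: D_def L_def Ls)
  qed
  have E0: "E 0 = 0"
    by (simp add: E_def lin_ext_def)
  have "R \<in> ?N \<longleftrightarrow> L R = 0" for R
    using zero[of R] red[of R] by (auto simp: E0)
  then show ?thesis
    unfolding tensor_eq_def L_def by (simp add: Ls)
qed


section \<open>Hopf algebras\<close>

text \<open>
  \<open>comult h\<close> is a formal sum \<open>\<Sum> h\<^sub>1 \<otimes> h\<^sub>2\<close> representing the coproduct of \<open>h\<close>, so the axioms
  that take place in \<open>H \<otimes> H\<close> or \<open>H \<otimes> H \<otimes> H\<close> hold modulo the tensor relations. The maps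
  \<open>lin_ext scale (\<lambda>(a, b). \<dots>)\<close> below are induced by bilinear maps and hence do not depend on
  the chosen formal sum.
\<close>

locale hopf_algebra = vector_space scale
  for scale :: "'k::field \<Rightarrow> 'h::ring_1 \<Rightarrow> 'h" +
  fixes comult :: "'h \<Rightarrow> ('h \<times> 'h \<Rightarrow>\<^sub>0 'k)"
    and counit :: "'h \<Rightarrow> 'k"
    and antipode :: "'h \<Rightarrow> 'h"
  assumes scale_mult_left: "scale c x * y = scale c (x * y)"
    and scale_mult_right: "x * scale c y = scale c (x * y)"
    and comult_add: "tensor_eq scale scale (comult (x + y)) (comult x + comult y)"
    and comult_scale: "tensor_eq scale scale (comult (scale c x)) (fscale c (comult x))"
    and comult_one: "tensor_eq scale scale (comult 1) (Poly_Mapping.single (1, 1) 1)"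
    and comult_mult: "tensor_eq scale scale (comult (x * y)) (tensor_mult (comult x) (comult y))"
    and coassoc:
      "lin_ext fscale (\<lambda>(a, c). lin_ext fscale (\<lambda>(a', b). Poly_Mapping.single (a', b, c) 1) (comult a)) (comult x)
       - lin_ext fscale (\<lambda>(a, c). lin_ext fscale (\<lambda>(b, c'). Poly_Mapping.single (a, b, c') 1) (comult c)) (comult x)
       \<in> tensor3_null scale"
    and counit_linear: "Vector_Spaces.linear scale (*) counit"
    and counit_one: "counit 1 = 1"
    and counit_mult: "counit (x * y) = counit x * counit y"
    and counit_left: "lin_ext scale (\<lambda>(a, b). scale (counit a) b) (comult x) = x"
    and counit_right: "lin_ext scale (\<lambda>(a, b). scale (counit b) a) (comult x) = x"
    and antipode_linear: "Vector_Spaces.linear scale scale antipode"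
    and antipode_left: "lin_ext scale (\<lambda>(a, b). antipode a * b) (comult x) = scale (counit x) 1"
    and antipode_right: "lin_ext scale (\<lambda>(a, b). a * antipode b) (comult x) = scale (counit x) 1"

definition subalgebra :: "('k::field \<Rightarrow> 'h::ring_1 \<Rightarrow> 'h) \<Rightarrow> 'h set \<Rightarrow> bool" where
  "subalgebra s A \<longleftrightarrow> module.subspace s A \<and> 1 \<in> A \<and> (\<forall>x\<in>A. \<forall>y\<in>A. x * y \<in> A)"

definition subcoalgebra ::
    "('k::field \<Rightarrow> 'h::ab_group_add \<Rightarrow> 'h) \<Rightarrow> ('h \<Rightarrow> ('h \<times> 'h \<Rightarrow>\<^sub>0 'k)) \<Rightarrow> 'h set \<Rightarrow> bool" where
  "subcoalgebra s \<Delta> D \<longleftrightarrow> module.subspace s D \<and> (\<forall>x\<in>D. \<Delta> x \<in> tensor_sub s s D D)"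

definition simple_subcoalgebra ::
    "('k::field \<Rightarrow> 'h::ab_group_add \<Rightarrow> 'h) \<Rightarrow> ('h \<Rightarrow> ('h \<times> 'h \<Rightarrow>\<^sub>0 'k)) \<Rightarrow> 'h set \<Rightarrow> bool" where
  "simple_subcoalgebra s \<Delta> D \<longleftrightarrow> subcoalgebra s \<Delta> D \<and> D \<noteq> {0} \<and>
    (\<forall>D'. subcoalgebra s \<Delta> D' \<longrightarrow> D' \<subseteq> D \<longrightarrow> D' = {0} \<or> D' = D)"

definition coradical ::
    "('k::field \<Rightarrow> 'h::ab_group_add \<Rightarrow> 'h) \<Rightarrow> ('h \<Rightarrow> ('h \<times> 'h \<Rightarrow>\<^sub>0 'k)) \<Rightarrow> 'h set" where
  "coradical s \<Delta> = module.span s (\<Union>{D. simple_subcoalgebra s \<Delta> D})"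

definition hopf_coradical ::
    "('k::field \<Rightarrow> 'h::ring_1 \<Rightarrow> 'h) \<Rightarrow> ('h \<Rightarrow> ('h \<times> 'h \<Rightarrow>\<^sub>0 'k)) \<Rightarrow> 'h set" where
  "hopf_coradical s \<Delta> = subalgebra s hull coradical s \<Delta>"

primrec std_filtration ::
    "('k::field \<Rightarrow> 'h::ring_1 \<Rightarrow> 'h) \<Rightarrow> ('h \<Rightarrow> ('h \<times> 'h \<Rightarrow>\<^sub>0 'k)) \<Rightarrow> nat \<Rightarrow> 'h set" where
  "std_filtration s \<Delta> 0 = hopf_coradical s \<Delta>"
| "std_filtration s \<Delta> (Suc n) =
    {h. \<exists>T\<in>tensor_sub s s (std_filtration s \<Delta> n) UNIV.
        \<exists>T'\<in>tensor_sub s s UNIV (hopf_coradical s \<Delta>). \<Delta> h = T + T'}"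


section \<open>Letters, words and their orders\<close>

text \<open>
  \<open>Plain y\<close> is the element \<open>y = y\<^sub>1\<close> of \<open>O\<close> regarded as a letter and \<open>Sub y a\<close> is the
  formal symbol \<open>y\<^sub>a\<close>. \<open>Os\<close> is the set \<open>O\<close>, \<open>t\<close> the degree map \<open>t\<^sub>O\<close> and \<open>lt\<close> a strict
  order on \<open>O\<close>.
\<close>

datatype 'o letter = Plain 'o | Sub 'o 'o

primrec C :: "'o letter \<Rightarrow> 'o" where
  "C (Plain y) = y"
| "C (Sub y a) = y"

definition letters :: "'o set \<Rightarrow> ('o \<Rightarrow> nat) \<Rightarrow> 'o letter set" where
  "letters Os t = Plain ` Os \<union> {Sub y a | y a. y \<in> Os \<and> t y \<ge> 1 \<and> a \<in> Os \<and> t a = 0}"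

definition letters0 :: "'o set \<Rightarrow> ('o \<Rightarrow> nat) \<Rightarrow> 'o letter set" where
  "letters0 Os t = {x \<in> letters Os t. t (C x) = 0}"

definition letters_plus :: "'o set \<Rightarrow> ('o \<Rightarrow> nat) \<Rightarrow> 'o letter set" where
  "letters_plus Os t = {x \<in> letters Os t. t (C x) \<ge> 1}"

definition less_O :: "('o \<Rightarrow> nat) \<Rightarrow> (nat \<Rightarrow> 'o rel) \<Rightarrow> 'o \<Rightarrow> 'o \<Rightarrow> bool" where
  "less_O t ord x y \<longleftrightarrow> t x < t y \<or> (t x = t y \<and> x \<noteq> y \<and> (x, y) \<in> ord (t x))"

fun less_C :: "('o \<Rightarrow> 'o \<Rightarrow> bool) \<Rightarrow> 'o letter \<Rightarrow> 'o letter \<Rightarrow> bool" where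
  "less_C lt (Plain z) (Sub z' a) \<longleftrightarrow> z = z'"
| "less_C lt (Sub z b) (Sub z' c) \<longleftrightarrow> z = z' \<and> lt b c"
| "less_C lt x (Plain z) \<longleftrightarrow> False"

definition less_X :: "('o \<Rightarrow> nat) \<Rightarrow> ('o \<Rightarrow> 'o \<Rightarrow> bool) \<Rightarrow> 'o letter \<Rightarrow> 'o letter \<Rightarrow> bool" where
  "less_X t lt x y \<longleftrightarrow> lt (C x) (C y) \<or> (C x = C y \<and> t (C x) \<ge> 1 \<and> less_C lt x y)"

definition mlex :: "('z \<Rightarrow> 'z \<Rightarrow> bool) \<Rightarrow> 'z list \<Rightarrow> 'z list \<Rightarrow> bool" where
  "mlex lt \<alpha> \<beta> \<longleftrightarrow> (\<exists>\<eta>. \<eta> \<noteq> [] \<and> \<beta> = \<eta> @ \<alpha>) \<or>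
    (\<exists>\<eta> \<zeta> \<gamma> x y. \<alpha> = \<eta> @ [x] @ \<gamma> \<and> \<beta> = \<zeta> @ [y] @ \<gamma> \<and> lt x y)"

definition less_Ow :: "('o \<Rightarrow> 'o \<Rightarrow> bool) \<Rightarrow> 'o list \<Rightarrow> 'o list \<Rightarrow> bool" where
  "less_Ow lt \<alpha> \<beta> \<longleftrightarrow> (\<alpha> = [] \<and> \<beta> \<noteq> []) \<or>
    (\<alpha> \<noteq> [] \<and> \<beta> \<noteq> [] \<and>
      (lt (last \<alpha>) (last \<beta>) \<or>
       last \<alpha> = last \<beta> \<and> (length \<alpha> < length \<beta> \<or> length \<alpha> = length \<beta> \<and> mlex lt \<alpha> \<beta>)))"

definition less_Xw :: "('o \<Rightarrow> nat) \<Rightarrow> ('o \<Rightarrow> 'o \<Rightarrow> bool) \<Rightarrow> 'o letter list \<Rightarrow> 'o letter list \<Rightarrow> bool" where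
  "less_Xw t lt \<alpha> \<beta> \<longleftrightarrow> less_Ow lt (map C \<alpha>) (map C \<beta>) \<or>
    (map C \<alpha> = map C \<beta> \<and> mlex (less_X t lt) \<alpha> \<beta>)"

definition LW :: "('z list \<Rightarrow> 'z list \<Rightarrow> bool) \<Rightarrow> ('z list \<Rightarrow>\<^sub>0 'k::field) \<Rightarrow> 'z list" where
  "LW ltw f = (THE w. w \<in> Poly_Mapping.keys f \<and> (\<forall>v\<in>Poly_Mapping.keys f. v \<noteq> w \<longrightarrow> ltw v w))"

definition reducible :: "('z list \<Rightarrow> 'z list \<Rightarrow> bool) \<Rightarrow> ('z list \<Rightarrow>\<^sub>0 'k::field) set \<Rightarrow> 'z list \<Rightarrow> bool" where
  "reducible ltw I w \<longleftrightarrow> (\<exists>f\<in>I. f \<noteq> 0 \<and> w = LW ltw f)"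


section \<open>The framework\<close>

primrec letter_map ::
    "('k::field \<Rightarrow> 'h::ring_1 \<Rightarrow> 'h) \<Rightarrow> ('h \<Rightarrow> ('h \<times> 'h \<Rightarrow>\<^sub>0 'k)) \<Rightarrow> ('h \<Rightarrow> 'h)
      \<Rightarrow> ('o \<Rightarrow> 'h) \<Rightarrow> 'o letter \<Rightarrow> 'h" where
  "letter_map s \<Delta> S f (Plain y) = f y"
| "letter_map s \<Delta> S f (Sub y a) = lin_ext s (\<lambda>(u, v). u * f y * S v) (\<Delta> (f a))"

text \<open>
  \<open>\<Delta>\<close> is an algebra map from \<open>\<k>\<langle>X\<rangle>\<close> to \<open>\<k>\<langle>X\<rangle> \<otimes> \<k>\<langle>X\<rangle>\<close>; its values outside \<open>\<k>\<langle>X\<rangle>\<close> are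
  irrelevant.
\<close>

definition free_comult_hom ::
    "'x set \<Rightarrow> (('x list \<Rightarrow>\<^sub>0 'k::field) \<Rightarrow> ('x list \<times> 'x list \<Rightarrow>\<^sub>0 'k)) \<Rightarrow> bool" where
  "free_comult_hom X \<Delta> \<longleftrightarrow>
    (\<forall>p\<in>free_algebra X. \<Delta> p \<in> free_tensor_algebra X) \<and>
    (\<forall>p\<in>free_algebra X. \<forall>q\<in>free_algebra X. \<Delta> (p + q) = \<Delta> p + \<Delta> q) \<and>
    (\<forall>c. \<forall>p\<in>free_algebra X. \<Delta> (fscale c p) = fscale c (\<Delta> p)) \<and>
    \<Delta> 1 = 1 \<and>
    (\<forall>p\<in>free_algebra X. \<forall>q\<in>free_algebra X. \<Delta> (p * q) = \<Delta> p * \<Delta> q)"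

text \<open>
  The finite sums are indexed by lists. In the second clause a list entry \<open>(u, v, q)\<close> stands
  for the summand \<open>x'\<^sub>+ x'\<^sub>0 \<otimes> x''\<close>, where \<open>u = x'\<^sub>+\<close> and \<open>v = x'\<^sub>0\<close> are words of length at
  most one.
\<close>

definition skew_triangular ::
    "'o set \<Rightarrow> ('o \<Rightarrow> nat) \<Rightarrow> ('o \<Rightarrow> 'o \<Rightarrow> bool)
      \<Rightarrow> (('o letter list \<Rightarrow>\<^sub>0 'k::field) \<Rightarrow> ('o letter list \<times> 'o letter list \<Rightarrow>\<^sub>0 'k)) \<Rightarrow> bool" where
  "skew_triangular Os t lt \<Delta> \<longleftrightarrow>
    (\<forall>x\<in>letters0 Os t. \<exists>r\<in>letter_span (letters0 Os t). \<exists>ts.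
      (\<forall>(x', q)\<in>set ts. x' \<in> letters0 Os t \<and> x' \<noteq> x \<and> q \<in> letter_span (letters0 Os t)) \<and>
      \<Delta> (Poly_Mapping.single [x] 1) =
        free_tensor (Poly_Mapping.single [x] 1) (1 - r) + free_tensor 1 (Poly_Mapping.single [x] 1)
        + (\<Sum>(x', q)\<leftarrow>ts. free_tensor (Poly_Mapping.single [x'] 1) q)) \<and>
    (\<forall>x\<in>letters_plus Os t. \<exists>ts.
      (\<forall>(u, v, q)\<in>set ts.
        (u = [] \<or> (\<exists>z\<in>letters_plus Os t. u = [z] \<and> t (C z) < t (C x) \<and> lt (C z) (C x))) \<and>
        (v = [] \<or> (\<exists>a\<in>letters0 Os t. v = [a])) \<and>
        u @ v \<noteq> [] \<and> q \<in> free_algebra_plus (letters Os t)) \<and>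
      \<Delta> (Poly_Mapping.single [x] 1) =
        free_tensor (Poly_Mapping.single [x] 1) 1 + free_tensor 1 (Poly_Mapping.single [x] 1)
        + (\<Sum>(u, v, q)\<leftarrow>ts. free_tensor (Poly_Mapping.single (u @ v) 1) q))"

locale hopf_framework = hopf_algebra scale comult counit antipode
  for scale :: "'k::field \<Rightarrow> 'h::ring_1 \<Rightarrow> 'h"
    and comult :: "'h \<Rightarrow> ('h \<times> 'h \<Rightarrow>\<^sub>0 'k)"
    and counit :: "'h \<Rightarrow> 'k"
    and antipode :: "'h \<Rightarrow> 'h" +
  fixes Os :: "'o set"
    and t :: "'o \<Rightarrow> nat"
    and ord :: "nat \<Rightarrow> 'o rel"
    and f :: "'o \<Rightarrow> 'h"
    and \<Delta> :: "('o letter list \<Rightarrow>\<^sub>0 'k) \<Rightarrow> ('o letter list \<times> 'o letter list \<Rightarrow>\<^sub>0 'k)"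
  assumes antipode_hopf_coradical:
      "antipode ` hopf_coradical scale comult \<subseteq> hopf_coradical scale comult"
    and counit_f: "y \<in> Os \<Longrightarrow> counit (f y) = 0"
    and generates: "subalgebra scale hull (f ` Os) = UNIV"
    and degree: "y \<in> Os \<Longrightarrow> t y = (LEAST n. f y \<in> std_filtration scale comult n)"
    and basis: "\<exists>B. bij_betw f {y \<in> Os. t y = 0} B \<and> independent B \<and>
      span B = {h \<in> hopf_coradical scale comult. counit h = 0}"
    and ord: "well_order_on {y \<in> Os. t y = n} (ord n)"
    and \<Delta>_hom: "free_comult_hom (letters Os t) \<Delta>"
    and \<Delta>_compat: "p \<in> free_algebra (letters Os t) \<Longrightarrow>
      tensor_eq scale scale (comult (free_alg_hom scale (letter_map scale comult antipode f) p))
        (lin_ext fscale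
          (\<lambda>(u, v). Poly_Mapping.single
            (free_alg_hom scale (letter_map scale comult antipode f) (Poly_Mapping.single u 1),
             free_alg_hom scale (letter_map scale comult antipode f) (Poly_Mapping.single v 1)) 1)
          (\<Delta> p))"
    and \<Delta>_skew: "skew_triangular Os t (less_O t ord) \<Delta>"

end

theory Submission
  imports Defs
begin

text \<open>
  Let \<open>x\<close> be a reducible letter of positive degree, \<open>z = C x\<close>, and let \<open>A\<close> be the subalgebra of \<open>H\<close>
  generated by the letters of class below \<open>z\<close>. Skew-triangularity makes \<open>A\<close> a right coideal
  subalgebra that contains the Hopf coradical. In a word smaller than \<open>x\<close> that is not a letter of
  the class \<open>z\<close> the last letter lies in \<open>A\<close>, so a linear combination \<open>v\<close> of \<open>x\<close> and
  smaller letters of its class lies in \<open>A + H A\<^sup>+\<close>; moreover \<open>\<Delta> v - v \<otimes> 1 \<in> A \<otimes> H\<close>. Such a \<open>v\<close> belongs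
  to \<open>A\<close>: the image of \<open>v\<close> in the relative Hopf module \<open>H / A\<close> is coinvariant, \<open>H / A\<close> has a
  filtration by free \<open>A\<close>-modules generated by coinvariants, and hence a nonzero coinvariant
  does not lie in \<open>(H / A) A\<^sup>+\<close>.
\<close>

section \<open>Bilinear maps and tensors\<close>

text \<open>The order on words compares last letters first and lengths second. Hence a non-empty
  word below the letter \<open>x\<close> either ends in a letter of a lower class or is itself a
  letter of the class of \<open>x\<close>; in the first case its last letter has counit zero, which
  is where the right-hand factor from the augmentation ideal of \<open>A\<close> comes from. The
  obstacle is that \<open>A\<close> is only a right coideal subalgebra: it need not be stable under
  the antipode, so the structure theorem for Hopf modules does not apply to it. Antipode stability
  is available only for the Hopf coradical \<open>B\<close>. The freeness over \<open>A\<close>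
  therefore rests on a statement about \<open>B\<close>: a nonzero right coideal that is stable
  under right multiplication by \<open>B\<close> contains 1. It is proved by descending the
  filtration by total degree of words. Once \<open>v\<close> is in \<open>A\<close>, solving for
  \<open>x\<close> may leave a constant term, which the counit removes, and further reducible
  letters, which a well-founded induction removes. For the version with letters of \<open>O\<close>,
  the element \<open>y_a\<close> lies in \<open>B y B\<close>, and \<open>y\<close> precedes
  \<open>y_a\<close>.\<close>

lemma lin_ext_compose:
  assumes "vector_space s"
  shows "lin_ext s g (lin_ext fscale \<phi> T) = lin_ext s (\<lambda>x. lin_ext s g (\<phi> x)) T"
proof -
  interpret vector_space s by fact
  have sum: "lin_ext s g (\<Sum>x\<in>A. h x) = (\<Sum>x\<in>A. lin_ext s g (h x))" for A :: "'z set" and h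
    by (induction A rule: infinite_finite_induct) (simp_all add: lin_ext_add[OF assms], simp_all add: lin_ext_def)
  show ?thesis
    unfolding lin_ext_def[of fscale] sum lin_ext_scale[OF assms]
    by (simp add: lin_ext_def[of s _ T])
qed

definition bilinear_map where
  "bilinear_map s1 s2 s3 \<beta> \<longleftrightarrow>
    (\<forall>a a' b. \<beta> (a + a') b = \<beta> a b + \<beta> a' b) \<and> (\<forall>a b b'. \<beta> a (b + b') = \<beta> a b + \<beta> a b') \<and>
    (\<forall>c a b. \<beta> (s1 c a) b = s3 c (\<beta> a b)) \<and> (\<forall>c a b. \<beta> a (s2 c b) = s3 c (\<beta> a b))"

text \<open>A bilinear map kills every generator of \<open>tensor_null\<close>. This turns relations
  between representatives modulo \<open>tensor_eq\<close> into honest equations in a vector space,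
  and lets a representative of a coproduct be exchanged for one adapted to a subspace.\<close>

lemma lin_ext_tensor_eq:
  assumes vs: "vector_space s3" and bil: "bilinear_map s1 s2 s3 \<beta>" and eq: "tensor_eq s1 s2 T T'"
  shows "lin_ext s3 (\<lambda>(a, b). \<beta> a b) T = lin_ext s3 (\<lambda>(a, b). \<beta> a b) T'"
proof -
  interpret vector_space s3 by fact
  note Ls = lin_ext_add[OF vs] lin_ext_diff[OF vs] lin_ext_scale[OF vs] lin_ext_single[OF vs]
  have "lin_ext s3 (\<lambda>(a, b). \<beta> a b) R = 0" if "R \<in> tensor_null s1 s2" for R
    using that unfolding tensor_null_def
  proof (induction rule: fscale.span_induct_alt)
    case base
    show ?case by (simp add: lin_ext_def)
  next
    case (step c R R')
    have "lin_ext s3 (\<lambda>(a, b). \<beta> a b) R = 0"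
      using step(1) bil unfolding bilinear_map_def
      by (elim UnE CollectE exE conjE) (simp_all add: Ls)
    then show ?case using step(2) by (simp add: Ls)
  qed
  from this[of "T - T'"] eq show ?thesis by (simp add: tensor_eq_def Ls)
qed

text \<open>The trilinear analogue, through which coassociativity becomes usable.\<close>

lemma lin_ext_tensor3_null:
  assumes vs: "vector_space s" and R: "R \<in> tensor3_null s"
    and lin1: "\<And>b c. Vector_Spaces.linear s s (\<lambda>a. \<tau> a b c)"
    and lin2: "\<And>a c. Vector_Spaces.linear s s (\<lambda>b. \<tau> a b c)"
    and lin3: "\<And>a b. Vector_Spaces.linear s s (\<lambda>c. \<tau> a b c)"
  shows "lin_ext s (\<lambda>(a, b, c). \<tau> a b c) R = 0"
proof -
  interpret vector_space s by fact
  note Ls = lin_ext_add[OF vs] lin_ext_diff[OF vs] lin_ext_scale[OF vs] lin_ext_single[OF vs]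
  note lins = lin1[unfolded Vector_Spaces.linear_iff] lin2[unfolded Vector_Spaces.linear_iff]
    lin3[unfolded Vector_Spaces.linear_iff]
  show ?thesis
    using R unfolding tensor3_null_def
  proof (induction rule: fscale.span_induct_alt)
    case base
    show ?case by (simp add: lin_ext_def)
  next
    case (step c R R')
    have "lin_ext s (\<lambda>(a, b, c). \<tau> a b c) R = 0"
      using step(1) by (elim UnE CollectE exE conjE) (simp_all add: Ls lins)
    then show ?case using step(2) by (simp add: Ls)
  qed
qed


section \<open>The left action of linear functionals\<close>

context hopf_algebra
begin

lemmas lin_ext_simps = lin_ext_add[OF vector_space_axioms] lin_ext_scale[OF vector_space_axioms]
  lin_ext_single[OF vector_space_axioms]

definition functional :: "('h \<Rightarrow> 'k) \<Rightarrow> bool" where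
  "functional \<chi> \<longleftrightarrow> (\<forall>x y. \<chi> (x + y) = \<chi> x + \<chi> y) \<and> (\<forall>c x. \<chi> (scale c x) = c * \<chi> x)"

lemma functional_sum:
  assumes "functional \<chi>"
  shows "\<chi> (\<Sum>x\<in>A. g x) = (\<Sum>x\<in>A. \<chi> (g x))"
proof -
  have "\<chi> (scale 0 0) = 0 * \<chi> 0"
    using assms unfolding functional_def by blast
  then have "\<chi> 0 = 0" by simp
  with assms show ?thesis
    by (induction A rule: infinite_finite_induct) (simp_all add: functional_def)
qed

lemma functional_counit: "functional counit"
  using counit_linear unfolding functional_def by (simp add: Vector_Spaces.linear_iff)

lemma functional_mult_right: "functional \<chi> \<Longrightarrow> functional (\<lambda>h. \<chi> (h * d))"
  by (simp add: functional_def scale_mult_left distrib_right)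

lemma functional_zero: "functional \<chi> \<Longrightarrow> \<chi> 0 = 0"
  using functional_sum[of \<chi> _ "{}"] by simp

text \<open>\<open>hit \<chi> h\<close> is \<open>(id \<otimes> \<chi>) (\<Delta> h)\<close>. A subspace \<open>N\<close> is a right coideal iff it is stable
  under all \<open>hit \<chi>\<close>; this replaces statements about membership in \<open>N \<otimes> H\<close>.\<close>

definition hit :: "('h \<Rightarrow> 'k) \<Rightarrow> 'h \<Rightarrow> 'h" where
  "hit \<chi> h = lin_ext scale (\<lambda>(a, b). scale (\<chi> b) a) (comult h)"

lemma lin_ext_comult_add:
  assumes "bilinear_map scale scale scale \<beta>"
  shows "lin_ext scale (\<lambda>(a, b). \<beta> a b) (comult (x + y)) =
    lin_ext scale (\<lambda>(a, b). \<beta> a b) (comult x) + lin_ext scale (\<lambda>(a, b). \<beta> a b) (comult y)"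
  using lin_ext_tensor_eq[OF vector_space_axioms assms comult_add, of x y]
  by (simp add: lin_ext_simps)

lemma lin_ext_comult_scale:
  assumes "bilinear_map scale scale scale \<beta>"
  shows "lin_ext scale (\<lambda>(a, b). \<beta> a b) (comult (scale c x)) =
    scale c (lin_ext scale (\<lambda>(a, b). \<beta> a b) (comult x))"
  using lin_ext_tensor_eq[OF vector_space_axioms assms comult_scale, of c x]
  by (simp add: lin_ext_simps)

lemma linear_lin_ext_comult:
  assumes "bilinear_map scale scale scale \<beta>"
  shows "Vector_Spaces.linear scale scale (\<lambda>h. lin_ext scale (\<lambda>(a, b). \<beta> a b) (comult h))"
  by (simp add: Vector_Spaces.linear_iff vector_space_axioms lin_ext_comult_add[OF assms]
      lin_ext_comult_scale[OF assms])

lemma bilinear_hit: "functional \<chi> \<Longrightarrow> bilinear_map scale scale scale (\<lambda>a b. scale (\<chi> b) a)"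
  by (simp add: bilinear_map_def functional_def scale_right_distrib scale_left_distrib mult.commute)

lemma linear_hit: "functional \<chi> \<Longrightarrow> Vector_Spaces.linear scale scale (hit \<chi>)"
  using linear_lin_ext_comult[OF bilinear_hit] by (simp add: hit_def[abs_def])

lemma hit_tensor_eq:
  assumes "functional \<chi>" "tensor_eq scale scale (comult h) T"
  shows "hit \<chi> h = lin_ext scale (\<lambda>(a, b). scale (\<chi> b) a) T"
  unfolding hit_def by (rule lin_ext_tensor_eq[OF vector_space_axioms bilinear_hit]) fact+

lemma hit_add_functional: "hit (\<lambda>h. \<chi> h + \<chi>' h) x = hit \<chi> x + hit \<chi>' x"
  by (simp add: hit_def lin_ext_def scale_left_distrib scale_right_distrib sum.distrib split_def)

lemma hit_scale_functional: "hit (\<lambda>h. c * \<chi> h) x = scale c (hit \<chi> x)"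
  by (simp add: hit_def lin_ext_def scale_sum_right split_def mult.commute mult.left_commute)

text \<open>Multiplicativity of the coproduct, with the second tensor factor of \<open>a\<close>
  absorbed into the functional. The representative \<open>T\<close> is left open so that one
  supported on \<open>B \<times> B\<close> or on \<open>A \<times> UNIV\<close> can be
  inserted.\<close>

lemma hit_mult:
  assumes \<chi>: "functional \<chi>" and T: "tensor_eq scale scale (comult a) T"
  shows "hit \<chi> (u * a) = lin_ext scale (\<lambda>(c, d). hit (\<lambda>h. \<chi> (h * d)) u * c) T"
proof -
  have "hit \<chi> (u * a) = lin_ext scale (\<lambda>(a, b). scale (\<chi> b) a) (tensor_mult (comult u) (comult a))"
    by (rule hit_tensor_eq[OF \<chi> comult_mult])
  also have "\<dots> = lin_ext scale (\<lambda>(p, q). lin_ext scale (\<lambda>(c, d). scale (\<chi> (q * d)) (p * c)) (comult a)) (comult u)"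
    unfolding tensor_mult_def lin_ext_compose[OF vector_space_axioms] split_def
    by (simp add: lin_ext_simps)
  also have "\<dots> = lin_ext scale (\<lambda>(c, d). hit (\<lambda>h. \<chi> (h * d)) u * c) (comult a)"
    unfolding hit_def lin_ext_def split_def scale_sum_right sum_distrib_right
    by (subst sum.swap) (simp add: scale_mult_left mult_ac)
  also have "\<dots> = lin_ext scale (\<lambda>(c, d). hit (\<lambda>h. \<chi> (h * d)) u * c) T"
  proof (rule lin_ext_tensor_eq[OF vector_space_axioms _ T])
    have "hit (\<lambda>h. \<chi> (h * (b + b'))) u = hit (\<lambda>h. \<chi> (h * b)) u + hit (\<lambda>h. \<chi> (h * b')) u" for b b'
      using \<chi> by (simp add: distrib_left functional_def hit_add_functional)
    moreover have "hit (\<lambda>h. \<chi> (h * scale k b)) u = scale k (hit (\<lambda>h. \<chi> (h * b)) u)" for k b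
      using \<chi> by (simp add: functional_def hit_scale_functional scale_mult_right)
    ultimately show "bilinear_map scale scale scale (\<lambda>c d. hit (\<lambda>h. \<chi> (h * d)) u * c)"
      by (simp add: bilinear_map_def distrib_left distrib_right scale_mult_left scale_mult_right)
  qed
  finally show ?thesis .
qed

text \<open>Obtained by applying \<open>\<chi>\<close> to the left counit axiom. It serves to move
  from a nonzero element of a coideal to an element of the same coideal with nonzero counit.\<close>

lemma counit_hit:
  assumes "functional \<chi>"
  shows "counit (hit \<chi> h) = \<chi> h"
proof -
  have "\<chi> h = \<chi> (lin_ext scale (\<lambda>(a, b). scale (counit a) b) (comult h))"
    by (simp add: counit_left)
  also have "\<dots> = counit (hit \<chi> h)"
    using assms functional_counit unfolding hit_def lin_ext_def
    by (simp add: functional_sum[OF functional_counit] functional_sum[OF assms])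
      (simp add: functional_def split_def mult_ac)
  finally show ?thesis by simp
qed

lemma lin_ext_mem:
  assumes "subspace V" "\<And>x. x \<in> Poly_Mapping.keys T \<Longrightarrow> g x \<in> V"
  shows "lin_ext scale g T \<in> V"
  unfolding lin_ext_def using assms by (intro subspace_sum subspace_scale) auto

lemma antipode_add: "antipode (x + y) = antipode x + antipode y"
  and antipode_scale: "antipode (scale c x) = scale c (antipode x)"
  using antipode_linear by (simp_all add: Vector_Spaces.linear_iff)

lemmas algebra_rules = distrib_left distrib_right scale_mult_left scale_mult_right antipode_add antipode_scale

lemma span_mult:
  assumes "x \<in> span S" "y \<in> span S'" "\<And>a b. a \<in> S \<Longrightarrow> b \<in> S' \<Longrightarrow> a * b \<in> V" "subspace V"
  shows "x * y \<in> V"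
proof -
  have "a * y \<in> V" if "a \<in> S" for a
    using assms(2)
  proof (induction rule: span_induct_alt)
    case base
    show ?case using subspace_0[OF assms(4)] by simp
  next
    case (step c u v)
    then show ?case using assms(3)[OF that] assms(4)
      by (simp add: algebra_rules subspace_add subspace_scale)
  qed
  with assms(1) show ?thesis
  proof (induction rule: span_induct_alt)
    case base
    show ?case using subspace_0[OF assms(4)] by simp
  next
    case (step c u v)
    then show ?case using assms(4) by (simp add: algebra_rules subspace_add subspace_scale)
  qed
qed

lemma antipode_one: "antipode 1 = 1"
proof -
  have "bilinear_map scale scale scale (\<lambda>a b. antipode a * b)"
    using antipode_linear by (simp add: bilinear_map_def Vector_Spaces.linear_iff
      distrib_left distrib_right scale_mult_left scale_mult_right)
  from lin_ext_tensor_eq[OF vector_space_axioms this comult_one] antipode_left[of 1]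
  show ?thesis by (simp add: lin_ext_simps counit_one)
qed

end

section \<open>Coinvariants and augmentation ideals\<close>

text \<open>An abstract form of the filtration by total degree. In the application \<open>B\<close>
  is the Hopf coradical, \<open>W\<close> consists of the words in letters of positive degree and
  \<open>wt\<close> is the sum of the degrees. The assumption \<open>hit_P\<close> says that
  \<open>P w\<close> is coinvariant modulo lower weight.\<close>

locale filtered_hopf_algebra = hopf_algebra scale comult counit antipode
  for scale :: "'k::field \<Rightarrow> 'h::ring_1 \<Rightarrow> 'h"
    and comult :: "'h \<Rightarrow> ('h \<times> 'h \<Rightarrow>\<^sub>0 'k)"
    and counit :: "'h \<Rightarrow> 'k"
    and antipode :: "'h \<Rightarrow> 'h" +
  fixes B :: "'h set" and W :: "'w set" and P :: "'w \<Rightarrow> 'h" and wt :: "'w \<Rightarrow> nat"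
  assumes subalgebra_B: "subalgebra scale B"
    and antipode_B: "b \<in> B \<Longrightarrow> antipode b \<in> B"
    and comult_B: "b \<in> B \<Longrightarrow> comult b \<in> tensor_sub scale scale B B"
    and hit_P: "w \<in> W \<Longrightarrow> functional \<chi> \<Longrightarrow>
      hit \<chi> (P w) - scale (\<chi> 1) (P w) \<in> span {P w' * b | w' b. w' \<in> W \<and> wt w' < wt w \<and> b \<in> B}"
    and span_P: "\<exists>n. h \<in> span {P w * b | w b. w \<in> W \<and> wt w < n \<and> b \<in> B}"
begin

text \<open>With the strict inequality, \<open>F 0\<close> is the zero space and \<open>F 1\<close> is \<open>B\<close> in the case of interest.\<close>

definition F :: "nat \<Rightarrow> 'h set" where
  "F n = span {P w * b | w b. w \<in> W \<and> wt w < n \<and> b \<in> B}"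

lemma subspace_F: "subspace (F n)"
  unfolding F_def by (rule subspace_span)

lemma F_0: "F 0 = {0}"
  by (simp add: F_def)

lemma F_mono: "m \<le> n \<Longrightarrow> F m \<subseteq> F n"
  unfolding F_def by (rule span_mono) force

lemma mult_B: "b \<in> B \<Longrightarrow> b' \<in> B \<Longrightarrow> b * b' \<in> B"
  using subalgebra_B by (auto simp: subalgebra_def)

lemma F_mult_B:
  assumes "x \<in> F n" "b \<in> B"
  shows "x * b \<in> F n"
proof -
  have "b \<in> span {b}" by (simp add: span_base)
  with assms(1)[unfolded F_def] show ?thesis
  proof (rule span_mult)
    fix y b' assume "y \<in> {P w * b | w b. w \<in> W \<and> wt w < n \<and> b \<in> B}" "b' \<in> {b}"
    then show "y * b' \<in> F n"
      using mult_B[OF _ assms(2)] unfolding F_def by (intro span_base) (force simp: mult.assoc)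
  qed (rule subspace_F)
qed

text \<open>Modulo \<open>F (wt w) \<otimes> H\<close>, the coproduct of \<open>P w * b\<close> is
  the sum of the terms \<open>P w * c \<otimes> d\<close>, where the \<open>c \<otimes> d\<close>
  come from the coproduct of \<open>b\<close>. So only the leading terms, with coefficient
  \<open>\<chi> d\<close>, have to be checked separately; the two uses below differ just in how
  these are handled.\<close>

lemma hit_F_word:
  assumes \<chi>: "functional \<chi>" and w: "w \<in> W" and b: "b \<in> B"
    and V: "subspace V" "F (wt w) \<subseteq> V"
    and d: "\<And>c d. c \<in> B \<Longrightarrow> d \<in> B \<Longrightarrow> scale (\<chi> d) (P w * c) \<in> V"
  shows "hit \<chi> (P w * b) \<in> V"
proof -
  obtain T where T: "Poly_Mapping.keys T \<subseteq> B \<times> B" "tensor_eq scale scale (comult b) T"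
    using comult_B[OF b] by (auto simp: tensor_sub_def)
  show ?thesis
    unfolding hit_mult[OF \<chi> T(2)]
  proof (rule lin_ext_mem[OF V(1)], clarify)
    fix c d assume "(c, d) \<in> Poly_Mapping.keys T"
    with T have cd: "c \<in> B" "d \<in> B" by auto
    have "(hit (\<lambda>h. \<chi> (h * d)) (P w) - scale (\<chi> (1 * d)) (P w)) * c \<in> F (wt w)"
      unfolding F_def by (rule F_mult_B[unfolded F_def, OF hit_P[OF w functional_mult_right[OF \<chi>]] cd(1)])
    then have "(hit (\<lambda>h. \<chi> (h * d)) (P w) - scale (\<chi> (1 * d)) (P w)) * c + scale (\<chi> d) (P w * c) \<in> V"
      using V d[OF cd] by (intro subspace_add) auto
    then show "hit (\<lambda>h. \<chi> (h * d)) (P w) * c \<in> V"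
      by (simp add: left_diff_distrib scale_mult_left)
  qed
qed

lemma hit_span:
  assumes \<chi>: "functional \<chi>" and "h \<in> span S" "subspace V" "\<And>x. x \<in> S \<Longrightarrow> hit \<chi> x \<in> V"
  shows "hit \<chi> h \<in> V"
  using assms(2)
proof (induction rule: span_induct_alt)
  case base
  show ?case
    using linear_hit[OF \<chi>] subspace_0[OF assms(3)] unfolding Vector_Spaces.linear_iff
    by (metis scale_zero_left)
next
  case (step c y z)
  then show ?case
    using linear_hit[OF \<chi>] assms(3,4) unfolding Vector_Spaces.linear_iff
    by (simp add: subspace_add subspace_scale)
qed

lemma hit_F:
  assumes \<chi>: "functional \<chi>" and "h \<in> F n"
  shows "hit \<chi> h \<in> F n"
  using assms(2) unfolding F_def[of n]
proof (rule hit_span[OF \<chi>]; (fold F_def)?)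
  fix x assume "x \<in> {P w * b | w b. w \<in> W \<and> wt w < n \<and> b \<in> B}"
  then obtain w b where x: "x = P w * b" "w \<in> W" "wt w < n" "b \<in> B" by blast
  then have "scale k (P w * c) \<in> F n" if "c \<in> B" for c k
    using that unfolding F_def by (intro span_scale span_base) blast
  then show "hit \<chi> x \<in> F n"
    unfolding x(1) using F_mono[of "wt w" n] x by (intro hit_F_word[OF \<chi>]) (auto simp: subspace_F)
qed (rule subspace_F)

text \<open>In a leading term the second factor lies in \<open>B\<close>, where
  \<open>\<chi>\<close> vanishes, so only lower weights survive.\<close>

lemma hit_F_Suc:
  assumes \<chi>: "functional \<chi>" "\<And>b. b \<in> B \<Longrightarrow> \<chi> b = 0" and "h \<in> F (Suc n)"
  shows "hit \<chi> h \<in> F n"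
  using assms(3) unfolding F_def[of "Suc n"]
proof (rule hit_span[OF \<chi>(1)])
  fix x assume "x \<in> {P w * b | w b. w \<in> W \<and> wt w < Suc n \<and> b \<in> B}"
  then obtain w b where x: "x = P w * b" "w \<in> W" "wt w < Suc n" "b \<in> B" by blast
  show "hit \<chi> x \<in> F n"
    unfolding x(1) using F_mono[of "wt w" n] x \<chi>(2) subspace_0[OF subspace_F]
    by (intro hit_F_word[OF \<chi>(1)]) (auto simp: subspace_F)
qed (rule subspace_F)

text \<open>The antipode identity \<open>\<Sum> j\<^sub>1 S(j\<^sub>2) = \<epsilon>(j)\<close> is expanded along a basis of \<open>H\<close> extending one
  of \<open>B\<close>. If \<open>j\<close> has minimal filtration degree in \<open>J\<close>, only the basis vectors in \<open>B\<close> contribute.\<close>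

lemma one_mem_coideal:
  assumes J: "subspace J" "J \<noteq> {0}" "\<And>x b. x \<in> J \<Longrightarrow> b \<in> B \<Longrightarrow> x * b \<in> J"
    and hit_J: "\<And>\<chi> x. functional \<chi> \<Longrightarrow> x \<in> J \<Longrightarrow> hit \<chi> x \<in> J"
  shows "1 \<in> J"
proof -
  obtain Bas where Bas: "Bas \<subseteq> B" "independent Bas" "B \<subseteq> span Bas"
    using maximal_independent_subset[of B] by blast
  define E where "E = extend_basis Bas"
  have E: "independent E" "span E = UNIV" "Bas \<subseteq> E"
    using independent_extend_basis[OF Bas(2)] span_extend_basis[OF Bas(2)]
      extend_basis_superset[OF Bas(2)] by (auto simp: E_def)
  define co where "co e h = representation E h e" for e h
  have co: "functional (co e)" for e
    unfolding functional_def co_def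
    using E by (simp add: representation_add representation_scale)
  \<comment> \<open>Coordinates at basis vectors outside \<open>Bas\<close> vanish on
    \<open>B\<close>, so by \<open>hit_F_Suc\<close> the corresponding \<open>hit\<close> lowers the
    filtration degree.\<close>
  have co_B: "co e b = 0" if "b \<in> B" "e \<notin> Bas" for b e
  proof -
    have "b \<in> span Bas" using Bas(3) that(1) by blast
    from representation_extend[OF E(1) this E(3)] show ?thesis
      using that(2) representation_ne_zero[of Bas b e] by (auto simp: co_def)
  qed
  have expand: "h = (\<Sum>e\<in>E0. scale (co e h) e)" if "finite E0" "{e. co e h \<noteq> 0} \<subseteq> E0" for h E0
  proof -
    have "h = (\<Sum>e | co e h \<noteq> 0. scale (co e h) e)"
      using sum_nonzero_representation_eq[OF E(1), of h] E(2) by (simp add: co_def)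
    also have "\<dots> = (\<Sum>e\<in>E0. scale (co e h) e)"
      using that by (intro sum.mono_neutral_left) auto
    finally show ?thesis .
  qed
  have fin: "finite {e. co e h \<noteq> 0}" for h
    unfolding co_def by (rule finite_representation)
  obtain x where x: "x \<in> J" "x \<noteq> 0"
    using J subspace_0[OF J(1)] by blast
  obtain n0 where "x \<in> F n0"
    using span_P[of x] by (auto simp: F_def)
  with x have ex: "\<exists>n. \<exists>x\<in>J. x \<noteq> 0 \<and> x \<in> F n" by blast
  define n where "n = (LEAST n. \<exists>x\<in>J. x \<noteq> 0 \<and> x \<in> F n)"
  obtain j where j: "j \<in> J" "j \<noteq> 0" "j \<in> F n"
    using LeastI_ex[OF ex] by (auto simp: n_def)
  then have "n \<noteq> 0" using F_0 by (metis singletonD)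
  then obtain m where m: "n = Suc m" by (cases n) auto
  have min: "x = 0" if "x \<in> J" "x \<in> F m" for x
    using not_less_Least[of m "\<lambda>n. \<exists>x\<in>J. x \<noteq> 0 \<and> x \<in> F n"] that m by (auto simp: n_def)
  have "\<exists>e. co e j \<noteq> 0"
    using expand[of "{}" j] j(2) by auto
  then obtain e0 where e0: "co e0 j \<noteq> 0" by blast
  \<comment> \<open>The antipode identity returns only the counit, which may vanish on
    \<open>j\<close>. By \<open>counit_hit\<close> the counit of \<open>j'\<close> is a nonzero
    coordinate of \<open>j\<close>, while \<open>j'\<close> stays in both \<open>J\<close> and
    \<open>F n\<close>.\<close>
  define j' where "j' = hit (co e0) j"
  have j': "j' \<in> J" "j' \<in> F n" "counit j' \<noteq> 0"
    using hit_J[OF co j(1)] hit_F[OF co j(3)] e0 by (simp_all add: j'_def counit_hit[OF co])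
  define E0 where "E0 = (\<Union>(a, b)\<in>Poly_Mapping.keys (comult j'). {e. co e b \<noteq> 0})"
  have finE0: "finite E0"
    unfolding E0_def using fin by auto
  have lin: "antipode (\<Sum>e\<in>S. scale (r e) e) = (\<Sum>e\<in>S. scale (r e) (antipode e))" for S r
    using antipode_linear[folded module_hom_eq_linear]
    by (simp add: module_hom.sum module_hom.scale)
  have "scale (counit j') 1 = lin_ext scale (\<lambda>(a, b). a * antipode b) (comult j')"
    by (simp add: antipode_right)
  also have "\<dots> = (\<Sum>(a, b)\<in>Poly_Mapping.keys (comult j'). \<Sum>e\<in>E0.
      scale (Poly_Mapping.lookup (comult j') (a, b)) (scale (co e b) a * antipode e))"
    unfolding lin_ext_def
  proof (rule sum.cong[OF refl], clarify)
    fix a b assume "(a, b) \<in> Poly_Mapping.keys (comult j')"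
    then have "b = (\<Sum>e\<in>E0. scale (co e b) e)"
      by (intro expand finE0) (auto simp: E0_def)
    then have "antipode b = (\<Sum>e\<in>E0. scale (co e b) (antipode e))"
      by (metis lin)
    then show "scale (Poly_Mapping.lookup (comult j') (a, b)) (a * antipode b) =
        (\<Sum>e\<in>E0. scale (Poly_Mapping.lookup (comult j') (a, b)) (scale (co e b) a * antipode e))"
      by (simp only: sum_distrib_left scale_sum_right scale_mult_left scale_mult_right)
  qed
  also have "\<dots> = (\<Sum>e\<in>E0. hit (co e) j' * antipode e)"
    unfolding hit_def lin_ext_def split_def
    by (subst sum.swap) (simp add: sum_distrib_right scale_mult_left)
  also have "\<dots> \<in> J"
  proof (intro subspace_sum[OF J(1)])
    fix e
    show "hit (co e) j' * antipode e \<in> J"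
    proof (cases "e \<in> Bas")
      case True
      then show ?thesis using Bas by (intro J hit_J co j') (auto intro: antipode_B)
    next
      case False
      \<comment> \<open>Outside \<open>Bas\<close> the coefficient drops to degree
        \<open>m = n - 1\<close> but remains in \<open>J\<close>, so it vanishes by minimality. The
        surviving terms are multiplied by antipodes of elements of \<open>B\<close>, under which
        \<open>J\<close> is stable.\<close>
      have "hit (co e) j' \<in> F m"
        using False j'(2) by (intro hit_F_Suc co co_B) (simp_all add: m)
      then have "hit (co e) j' = 0"
        by (intro min hit_J co j')
      then show ?thesis using subspace_0[OF J(1)] by simp
    qed
  qed
  finally have "scale (inverse (counit j')) (scale (counit j') 1) \<in> J"
    by (rule subspace_scale[OF J(1)])
  with j'(3) show ?thesis by simp
qed

text \<open>For a subspace \<open>N\<close> this is the condition that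
  \<open>\<Delta> u - u \<otimes> 1\<close> lies in \<open>N \<otimes> H\<close>, that is, that the
  class of \<open>u\<close> in \<open>H / N\<close> is coinvariant, tested by functionals on the
  second factor.\<close>

definition coinvariant_mod :: "'h set \<Rightarrow> 'h \<Rightarrow> bool" where
  "coinvariant_mod N u \<longleftrightarrow> (\<forall>\<chi>. functional \<chi> \<longrightarrow> hit \<chi> u - scale (\<chi> 1) u \<in> N)"

end

section \<open>Relative Hopf submodules over a right coideal subalgebra\<close>

locale coideal_subalgebra = filtered_hopf_algebra +
  fixes A
  assumes subalgebra_A: "subalgebra scale A"
    and comult_A: "a \<in> A \<Longrightarrow> comult a \<in> tensor_sub scale scale A UNIV"
    and B_subset_A: "B \<subseteq> A"
begin

lemma subspace_A: "subspace A" and one_A: "1 \<in> A" and mult_A: "b \<in> A \<Longrightarrow> b' \<in> A \<Longrightarrow> b * b' \<in> A"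
  using subalgebra_A by (auto simp: subalgebra_def)

text \<open>The submodules of \<open>H\<close> in the category of relative Hopf modules.\<close>

definition hopf_submodule :: "'b set \<Rightarrow> bool" where
  "hopf_submodule N \<longleftrightarrow> subspace N \<and> (\<forall>x\<in>N. \<forall>a\<in>A. x * a \<in> N) \<and>
    (\<forall>\<chi>. functional \<chi> \<longrightarrow> (\<forall>x\<in>N. hit \<chi> x \<in> N))"

lemma hit_A:
  assumes "functional \<chi>" "a \<in> A"
  shows "hit \<chi> a \<in> A"
proof -
  obtain T where T: "Poly_Mapping.keys T \<subseteq> A \<times> UNIV" "tensor_eq scale scale (comult a) T"
    using comult_A[OF assms(2)] by (auto simp: tensor_sub_def)
  show ?thesis
    unfolding hit_tensor_eq[OF assms(1) T(2)]
    using T(1) by (intro lin_ext_mem[OF subspace_A]) (auto intro!: subspace_scale[OF subspace_A])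
qed

lemma hopf_submodule_A: "hopf_submodule A"
  by (simp add: hopf_submodule_def subspace_A mult_A hit_A)

text \<open>Since \<open>\<Delta> a\<close> has left factors in \<open>A\<close> and
  \<open>N\<close> is stable under \<open>A\<close>, the coproduct of \<open>u * a\<close> agrees
  with \<open>(u \<otimes> 1) \<Delta> a\<close> modulo \<open>N \<otimes> H\<close>.\<close>

lemma hit_mult_coinvariant:
  assumes N: "hopf_submodule N" and u: "coinvariant_mod N u" and \<chi>: "functional \<chi>" and a: "a \<in> A"
  shows "hit \<chi> (u * a) - u * hit \<chi> a \<in> N"
proof -
  obtain T where T: "Poly_Mapping.keys T \<subseteq> A \<times> UNIV" "tensor_eq scale scale (comult a) T"
    using comult_A[OF a] by (auto simp: tensor_sub_def)
  have "hit \<chi> (u * a) - u * hit \<chi> a =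
      lin_ext scale (\<lambda>(c, d). (hit (\<lambda>h. \<chi> (h * d)) u - scale (\<chi> (1 * d)) u) * c) T"
    unfolding hit_mult[OF \<chi> T(2)] hit_tensor_eq[OF \<chi> T(2)] lin_ext_def
    by (simp only: sum_distrib_left sum_subtractf[symmetric], intro sum.cong refl)
      (simp add: scale_right_diff_distrib scale_mult_left scale_mult_right left_diff_distrib split_def)
  also have "\<dots> \<in> N"
  proof (rule lin_ext_mem, goal_cases)
    case (2 x)
    have "hit (\<lambda>h. \<chi> (h * snd x)) u - scale (\<chi> (1 * snd x)) u \<in> N"
      using u functional_mult_right[OF \<chi>] unfolding coinvariant_mod_def by blast
    moreover have "fst x \<in> A" using 2 T(1) by auto
    ultimately show ?case using N by (simp add: hopf_submodule_def split_def)
  qed (use N in \<open>simp add: hopf_submodule_def\<close>)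
  finally show ?thesis .
qed

text \<open>The annihilator \<open>J\<close> of the class of \<open>u\<close> is a right coideal in
  \<open>A\<close>, by \<open>hit_mult_coinvariant\<close>, and is stable under right multiplication
  by \<open>B\<close>. If it were nonzero it would contain 1, and \<open>u\<close> would lie in
  \<open>N\<close>.\<close>

lemma coinvariant_torsion_free:
  assumes N: "hopf_submodule N" and u: "coinvariant_mod N u" "u \<notin> N" and a: "a \<in> A" "u * a \<in> N"
  shows "a = 0"
proof (rule ccontr)
  assume "a \<noteq> 0"
  define J where "J = {a \<in> A. u * a \<in> N}"
  note N' = N[unfolded hopf_submodule_def]
  have "1 \<in> J"
  proof (rule one_mem_coideal)
    show "subspace J"
      using N' subspace_A
      by (auto simp: J_def subspace_def distrib_left scale_mult_right)
    show "J \<noteq> {0}" using \<open>a \<noteq> 0\<close> a by (auto simp: J_def)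
    show "x * b \<in> J" if "x \<in> J" "b \<in> B" for x b
      using that N' B_subset_A mult_A by (auto simp: J_def mult.assoc[symmetric])
    show "hit \<chi> x \<in> J" if "functional \<chi>" "x \<in> J" for \<chi> x
    proof -
      from that have x: "x \<in> A" "hit \<chi> (u * x) \<in> N" using N' by (auto simp: J_def)
      have "hit \<chi> (u * x) - (hit \<chi> (u * x) - u * hit \<chi> x) \<in> N"
        using x hit_mult_coinvariant[OF N u(1) that(1) x(1)] N' by (metis subspace_diff)
      then have "u * hit \<chi> x \<in> N" by (simp only: diff_diff_eq2 add_diff_cancel_left')
      then show ?thesis using hit_A[OF that(1) x(1)] by (simp add: J_def)
    qed
  qed
  then show False using u by (simp add: J_def)
qed

text \<open>When \<open>u\<close> is coinvariant modulo a Hopf submodule \<open>N\<close> and lies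
  outside it, the quotient of this space by \<open>N\<close> is a free \<open>A\<close>-module of
  rank one, by \<open>coinvariant_torsion_free\<close>.\<close>

definition adjoin :: "'b set \<Rightarrow> 'b \<Rightarrow> 'b set" where
  "adjoin N u = {x + u * a | x a. x \<in> N \<and> a \<in> A}"

lemma adjoinI: "n \<in> N \<Longrightarrow> a \<in> A \<Longrightarrow> n + u * a \<in> adjoin N u"
  unfolding adjoin_def by blast

lemma subset_adjoin: "N \<subseteq> adjoin N u"
proof
  fix x assume "x \<in> N"
  then have "x + u * 0 \<in> adjoin N u" by (intro adjoinI subspace_0[OF subspace_A])
  then show "x \<in> adjoin N u" by simp
qed

lemma mem_adjoin:
  assumes "subspace N"
  shows "u \<in> adjoin N u"
proof -
  have "0 + u * 1 \<in> adjoin N u" by (intro adjoinI subspace_0[OF assms] one_A)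
  then show ?thesis by simp
qed

lemma hopf_submodule_adjoin:
  assumes N: "hopf_submodule N" and u: "coinvariant_mod N u"
  shows "hopf_submodule (adjoin N u)"
proof -
  note N' = N[unfolded hopf_submodule_def]
  have "subspace (adjoin N u)"
  proof (rule subspaceI)
    show "0 \<in> adjoin N u"
      using subset_adjoin subspace_0[of N] N' by blast
  next
    fix x y assume "x \<in> adjoin N u" "y \<in> adjoin N u"
    then obtain n a n' a' where *: "x = n + u * a" "y = n' + u * a'" "n \<in> N" "n' \<in> N" "a \<in> A" "a' \<in> A"
      by (auto simp: adjoin_def)
    then have "x + y = (n + n') + u * (a + a')" by (simp add: distrib_left)
    with * N' subspace_A show "x + y \<in> adjoin N u"
      unfolding adjoin_def by (blast intro: subspace_add)
  next
    fix c x assume "x \<in> adjoin N u"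
    then obtain n a where *: "x = n + u * a" "n \<in> N" "a \<in> A"
      by (auto simp: adjoin_def)
    then have "scale c x = scale c n + u * scale c a" by (simp add: scale_right_distrib scale_mult_right)
    with * N' subspace_A show "scale c x \<in> adjoin N u"
      unfolding adjoin_def by (blast intro: subspace_scale)
  qed
  moreover have "x * b \<in> adjoin N u" if "x \<in> adjoin N u" "b \<in> A" for x b
  proof -
    from that obtain n a where *: "x = n + u * a" "n \<in> N" "a \<in> A"
      by (auto simp: adjoin_def)
    then have "x * b = n * b + u * (a * b)" by (simp add: distrib_right mult.assoc)
    with * N' that(2) mult_A show ?thesis unfolding adjoin_def by blast
  qed
  moreover have "hit \<chi> x \<in> adjoin N u" if \<chi>: "functional \<chi>" and x: "x \<in> adjoin N u" for \<chi> x
  proof -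
    from x obtain n a where *: "x = n + u * a" "n \<in> N" "a \<in> A"
      by (auto simp: adjoin_def)
    have "hit \<chi> x = (hit \<chi> n + (hit \<chi> (u * a) - u * hit \<chi> a)) + u * hit \<chi> a"
      using linear_hit[OF \<chi>] *(1) by (simp add: Vector_Spaces.linear_iff)
    moreover have "hit \<chi> n + (hit \<chi> (u * a) - u * hit \<chi> a) \<in> N"
      using N' \<chi> * hit_mult_coinvariant[OF N u \<chi>] by (intro subspace_add) auto
    ultimately show ?thesis unfolding adjoin_def using hit_A[OF \<chi> *(3)] by blast
  qed
  ultimately show ?thesis by (simp add: hopf_submodule_def)
qed

text \<open>For \<open>N\<close> containing \<open>A\<close>, this is the preimage in
  \<open>N\<close> of the subspace of \<open>N / A\<close> generated by the products with the kernel
  of the counit on \<open>A\<close>.\<close>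

definition aug :: "'b set \<Rightarrow> 'b set" where
  "aug N = span (A \<union> {x * a | x a. x \<in> N \<and> a \<in> A \<and> counit a = 0})"

text \<open>A generator \<open>(n + u * b) * a\<close> splits as \<open>n * a + u * (b * a)\<close>,
  and \<open>b * a\<close> inherits counit zero from \<open>a\<close>.\<close>

lemma aug_adjoin:
  assumes "k \<in> aug (adjoin N u)"
  shows "\<exists>k'\<in>aug N. \<exists>a\<in>A. counit a = 0 \<and> k = k' + u * a"
  using assms unfolding aug_def[of "adjoin N u"]
proof (induction rule: span_induct_alt)
  case base
  have "0 \<in> aug N" "0 \<in> A" "counit 0 = 0"
    using subspace_A by (auto simp: aug_def span_zero subspace_0 functional_zero functional_counit)
  then show ?case by force
next
  case (step c x y)
  obtain k' a where k': "k' \<in> aug N" "a \<in> A" "counit a = 0" "y = k' + u * a"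
    using step(2) by blast
  have "\<exists>k'\<in>aug N. \<exists>a\<in>A. counit a = 0 \<and> x = k' + u * a"
  proof (cases "x \<in> A")
    case True
    then have "x \<in> aug N" by (simp add: aug_def span_base)
    then show ?thesis
      using subspace_0[OF subspace_A] functional_zero[OF functional_counit]
      by (intro bexI[of _ x] bexI[of _ 0]) auto
  next
    case False
    with step(1) obtain n b a where *: "x = (n + u * b) * a" "n \<in> N" "b \<in> A" "a \<in> A" "counit a = 0"
      by (auto simp: adjoin_def)
    have "n * a \<in> aug N"
      unfolding aug_def using * by (intro span_base) blast
    then show ?thesis
      using * by (intro bexI[of _ "n * a"] bexI[of _ "b * a"])
        (auto simp: distrib_right mult.assoc counit_mult mult_A)
  qed
  then obtain k'' a'' where k'': "k'' \<in> aug N" "a'' \<in> A" "counit a'' = 0" "x = k'' + u * a''"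
    by blast
  have "scale c k'' + k' \<in> aug N"
    using k' k'' unfolding aug_def by (intro span_add span_scale)
  moreover have "scale c a'' + a \<in> A" "counit (scale c a'' + a) = 0"
    using k' k'' subspace_A functional_counit
    by (auto intro: subspace_add subspace_scale simp: functional_def)
  ultimately show ?case
    using k' k'' by (intro bexI[of _ "scale c k'' + k'"] bexI[of _ "scale c a'' + a"])
      (auto simp: algebra_simps scale_right_distrib scale_mult_right)
qed

text \<open>Membership in \<open>aug\<close> involves only finitely many elements, and these lie in
  a common member of a chain. This keeps the condition \<open>v \<notin> aug N\<close> alive under
  unions in the application of Zorn's lemma.\<close>

lemma mem_aug_Union:
  assumes chain: "subset.chain \<N> \<C>" and "\<C> \<noteq> {}" and "x \<in> aug (\<Union>\<C>)"
  shows "\<exists>N\<in>\<C>. x \<in> aug N"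
  using assms(3) unfolding aug_def[of "\<Union>\<C>"]
proof (induction rule: span_induct_alt)
  case base
  show ?case using \<open>\<C> \<noteq> {}\<close> by (auto simp: aug_def span_zero)
next
  case (step c x y)
  have mono: "aug N \<subseteq> aug N'" if "N \<subseteq> N'" for N N'
    unfolding aug_def using that by (intro span_mono) blast
  obtain N1 where N1: "N1 \<in> \<C>" "y \<in> aug N1" using step(2) by blast
  obtain N2 where N2: "N2 \<in> \<C>" "x \<in> aug N2"
    using step(1) \<open>\<C> \<noteq> {}\<close> unfolding aug_def by (blast intro: span_base)
  have "N1 \<subseteq> N2 \<or> N2 \<subseteq> N1"
    using chain N1(1) N2(1) by (auto simp: subset_chain_def)
  then obtain N where "N \<in> \<C>" "x \<in> aug N" "y \<in> aug N"
    using N1 N2 mono by blast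
  then show ?case unfolding aug_def by (blast intro: span_add span_scale)
qed

text \<open>Adjoining coinvariants one at a time exhausts \<open>H\<close>. Since each step adjoins a torsion-free
  generator, \<open>v\<close> never enters the augmentation.\<close>

theorem coinvariant_in_aug:
  assumes v: "coinvariant_mod A v" and aug: "v \<in> aug UNIV"
  shows "v \<in> A"
proof (rule ccontr)
  assume nv: "v \<notin> A"
  have sub_aug: "A \<subseteq> aug N" for N
    unfolding aug_def using span_superset by blast
  \<comment> \<open>Here \<open>v = k + v * a\<close> with \<open>k \<in> A\<close> would put
    \<open>v * (1 - a)\<close> into \<open>A\<close>; torsion-freeness then forces
    \<open>a = 1\<close>, against \<open>counit a = 0\<close>.\<close>
  have base: "v \<notin> aug (adjoin A v)"
  proof
    assume "v \<in> aug (adjoin A v)"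
    then obtain k a where ka: "k \<in> aug A" "a \<in> A" "counit a = 0" "v = k + v * a"
      using aug_adjoin by blast
    have "aug A \<subseteq> A"
      unfolding aug_def using mult_A by (intro span_minimal subspace_A) auto
    moreover have "v * (1 - a) = k"
      using ka(4) by (simp add: right_diff_distrib) (metis add_diff_cancel_right')
    ultimately have "v * (1 - a) \<in> A" using ka(1) by auto
    then have "1 - a = 0"
      by (intro coinvariant_torsion_free[OF hopf_submodule_A v nv]) (auto intro: subspace_diff subspace_A one_A ka)
    with ka(3) show False by (simp add: counit_one)
  qed
  \<comment> \<open>The condition \<open>v \<in> N\<close> is carried along because, in a
    decomposition \<open>v = k + P w * a\<close> with \<open>k \<in> aug N\<close>, it gives
    \<open>P w * a \<in> N\<close>.\<close>
  define \<N> where "\<N> = {N. hopf_submodule N \<and> A \<subseteq> N \<and> v \<in> N \<and> v \<notin> aug N}"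
  have "adjoin A v \<in> \<N>"
    using base subset_adjoin mem_adjoin[OF subspace_A] hopf_submodule_adjoin[OF hopf_submodule_A v] by (simp add: \<N>_def)
  moreover have "\<Union>\<C> \<in> \<N>" if C: "\<C> \<noteq> {}" "subset.chain \<N> \<C>" for \<C>
  proof -
    have mem: "N \<in> \<N>" if "N \<in> \<C>" for N using C(2) that by (auto simp: subset_chain_def)
    have up: "\<exists>N\<in>\<C>. x \<in> N \<and> y \<in> N" if "x \<in> \<Union>\<C>" "y \<in> \<Union>\<C>" for x y
      using C(2) that unfolding subset_chain_def by blast
    have "subspace (\<Union>\<C>)"
    proof (rule subspaceI)
      obtain N where "N \<in> \<C>" using C(1) by blast
      then show "0 \<in> \<Union>\<C>" using mem[of N] subspace_0[of N] by (auto simp: \<N>_def hopf_submodule_def)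
      show "x + y \<in> \<Union>\<C>" if "x \<in> \<Union>\<C>" "y \<in> \<Union>\<C>" for x y
        using up[OF that] mem unfolding \<N>_def hopf_submodule_def
        by (metis (mono_tags, lifting) UnionI mem_Collect_eq subspace_add)
      show "scale c x \<in> \<Union>\<C>" if "x \<in> \<Union>\<C>" for c x
        using that mem unfolding \<N>_def hopf_submodule_def
        by (metis (mono_tags, lifting) UnionE UnionI mem_Collect_eq subspace_scale)
    qed
    moreover have "x * a \<in> N" "functional \<chi> \<Longrightarrow> hit \<chi> x \<in> N" if "N \<in> \<C>" "x \<in> N" "a \<in> A" for N x a \<chi>
      using mem[OF that(1)] that by (auto simp: \<N>_def hopf_submodule_def)
    ultimately have "hopf_submodule (\<Union>\<C>)"
      unfolding hopf_submodule_def using one_A by (meson UnionE UnionI)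
    moreover have "A \<subseteq> \<Union>\<C>" "v \<in> \<Union>\<C>"
      using C(1) mem by (auto simp: \<N>_def)
    moreover have "v \<notin> aug (\<Union>\<C>)"
      using mem_aug_Union[OF C(2,1), of v] mem by (auto simp: \<N>_def)
    ultimately show ?thesis by (simp add: \<N>_def)
  qed
  ultimately obtain N where N: "N \<in> \<N>" and max: "\<And>M. M \<in> \<N> \<Longrightarrow> N \<subseteq> M \<Longrightarrow> M = N"
    using subset_Zorn_nonempty[of \<N>] by blast
  then have N': "hopf_submodule N" "A \<subseteq> N" "v \<in> N" "v \<notin> aug N" by (auto simp: \<N>_def)
  \<comment> \<open>Once the words of smaller weight are in \<open>N\<close>, the element
    \<open>P w\<close> is coinvariant modulo \<open>N\<close>. If it were outside \<open>N\<close>,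
    maximality would give \<open>v \<in> aug (adjoin N (P w))\<close>; torsion-freeness kills the
    contribution of \<open>P w\<close>, leaving \<open>v \<in> aug N\<close>.\<close>
  have P: "P w \<in> N" if "w \<in> W" for w
    using that
  proof (induction "wt w" arbitrary: w rule: less_induct)
    case less
    have F_N: "span {P w' * b |w' b. w' \<in> W \<and> wt w' < wt w \<and> b \<in> B} \<subseteq> N"
      using N' less(1) B_subset_A by (intro span_minimal) (auto simp: hopf_submodule_def)
    then have u: "coinvariant_mod N (P w)"
      using hit_P[OF less(2)] by (auto simp: coinvariant_mod_def)
    show "P w \<in> N"
    proof (rule ccontr)
      assume nu: "P w \<notin> N"
      have sub: "N \<subseteq> adjoin N (P w)"
        by (rule subset_adjoin)
      have "P w \<in> adjoin N (P w)"
        using N' by (intro mem_adjoin) (simp add: hopf_submodule_def)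
      then have "adjoin N (P w) \<noteq> N" using nu by auto
      then have "adjoin N (P w) \<notin> \<N>" using max sub by blast
      then have "v \<in> aug (adjoin N (P w))"
        using N' sub hopf_submodule_adjoin[OF N'(1) u] by (auto simp: \<N>_def)
      then obtain k a where ka: "k \<in> aug N" "a \<in> A" "v = k + P w * a"
        using aug_adjoin by blast
      have "aug N \<subseteq> N"
        unfolding aug_def using N' by (intro span_minimal) (auto simp: hopf_submodule_def)
      moreover have "P w * a = v - k" using ka(3) by simp
      ultimately have "P w * a \<in> N"
        using ka(1) N' by (auto simp: hopf_submodule_def intro: subspace_diff)
      then have "a = 0" using coinvariant_torsion_free[OF N'(1) u nu ka(2)] by simp
      with ka N' show False by simp
    qed
  qed
  have "h \<in> N" for h
  proof -
    obtain n where "h \<in> span {P w * b | w b. w \<in> W \<and> wt w < n \<and> b \<in> B}" using span_P by blast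
    also have "\<dots> \<subseteq> N"
      using N' P B_subset_A by (intro span_minimal) (auto simp: hopf_submodule_def)
    finally show ?thesis .
  qed
  then have "N = UNIV" by auto
  with N' aug show False by simp
qed

end

section \<open>The orders on letters and words\<close>

context
  fixes Os :: "'o set" and t :: "'o \<Rightarrow> nat" and ord :: "nat \<Rightarrow> 'o rel"
  assumes ord: "\<And>n. well_order_on {y \<in> Os. t y = n} (ord n)"
begin

lemma ord_transD: "(x, y) \<in> ord n \<Longrightarrow> (y, z) \<in> ord n \<Longrightarrow> (x, z) \<in> ord n"
  and ord_antisymD: "(x, y) \<in> ord n \<Longrightarrow> (y, x) \<in> ord n \<Longrightarrow> x = y"
  using ord[of n] unfolding order_on_defs by (auto dest: transD antisymD)

lemma less_O_irrefl: "\<not> less_O t ord x x"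
  by (simp add: less_O_def)

lemma less_O_trans: "less_O t ord x y \<Longrightarrow> less_O t ord y z \<Longrightarrow> less_O t ord x z"
  using ord_transD ord_antisymD unfolding less_O_def by (metis less_trans)

lemma less_O_total: "x \<in> Os \<Longrightarrow> y \<in> Os \<Longrightarrow> less_O t ord x y \<or> x = y \<or> less_O t ord y x"
  using ord[of "t x"] unfolding order_on_defs total_on_def less_O_def
  by (cases "t x" "t y" rule: linorder_cases) (simp_all, blast)

text \<open>Elements outside \<open>Os\<close> are compared by degree alone, so the outer induction
  on the degree covers them too.\<close>

lemma wf_less_O: "wf {(x, y). less_O t ord x y}"
proof (rule wfUNIVI)
  fix P x
  assume step: "\<forall>x. (\<forall>y. (y, x) \<in> {(x, y). less_O t ord x y} \<longrightarrow> P y) \<longrightarrow> P x"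
  have "\<forall>x. t x = n \<longrightarrow> P x" for n
  proof (induction n rule: less_induct)
    case (less n)
    have "wf (ord n - Id)" using ord[of n] by (simp add: well_order_on_def)
    then have "t x = n \<longrightarrow> P x" for x
    proof (induction x)
      case (less x)
      show ?case
      proof
        assume n: "t x = n"
        have "P y" if "less_O t ord y x" for y
          using that less less.IH \<open>\<And>m. m < n \<Longrightarrow> \<forall>x. t x = m \<longrightarrow> P x\<close> n by (auto simp: less_O_def)
        then show "P x" using step by blast
      qed
    qed
    then show ?case by blast
  qed
  then show "P x" by blast
qed

lemma less_X_irrefl: "\<not> less_X t (less_O t ord) x x"
  by (cases x) (simp_all add: less_X_def less_O_irrefl)

lemma less_X_trans:
  assumes "less_X t (less_O t ord) x y" "less_X t (less_O t ord) y z"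
  shows "less_X t (less_O t ord) x z"
proof -
  have "less_C (less_O t ord) x y \<Longrightarrow> less_C (less_O t ord) y z \<Longrightarrow> less_C (less_O t ord) x z"
    by (cases x; cases y; cases z) (auto intro: less_O_trans)
  with assms show ?thesis
    unfolding less_X_def by (metis less_O_trans)
qed

lemma less_X_total:
  assumes "x \<in> letters Os t" "y \<in> letters Os t"
  shows "less_X t (less_O t ord) x y \<or> x = y \<or> less_X t (less_O t ord) y x"
proof (cases "C x = C y")
  case True
  have a: "a = b \<or> less_O t ord a b \<or> less_O t ord b a" if "x = Sub z a" "y = Sub z b" for z a b
    using assms that less_O_total[of a b] by (auto simp: letters_def)
  have "t (C x) \<ge> 1" if "x = Sub z a \<or> y = Sub z a" for z a
    using assms that True by (auto simp: letters_def)
  with True a show ?thesis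
    unfolding less_X_def by (cases x; cases y) auto
next
  case False
  have "C x \<in> Os" "C y \<in> Os" using assms by (auto simp: letters_def)
  from less_O_total[OF this] False show ?thesis by (auto simp: less_X_def)
qed

lemma wf_less_X: "wf {(x, y). less_X t (less_O t ord) x y}"
proof (rule wf_subset)
  let ?R = "{(x, y). less_O t ord x y}"
  \<comment> \<open>The tag 0 places \<open>Plain y\<close> below every \<open>Sub y a\<close> of
    its class; the last component in the \<open>Plain\<close> case is a mere filler.\<close>
  let ?f = "\<lambda>x. (C x, case x of Plain y \<Rightarrow> (0::nat, y) | Sub y a \<Rightarrow> (1, a))"
  show "wf (inv_image (?R <*lex*> less_than <*lex*> ?R) ?f)"
    by (intro wf_inv_image wf_lex_prod wf_less_than wf_less_O)
  show "{(x, y). less_X t (less_O t ord) x y} \<subseteq> inv_image (?R <*lex*> less_than <*lex*> ?R) ?f"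
  proof (clarify)
    fix x y assume "less_X t (less_O t ord) x y"
    then show "(x, y) \<in> inv_image (?R <*lex*> less_than <*lex*> ?R) ?f"
      by (cases x; cases y) (auto simp: less_X_def)
  qed
qed

end

section \<open>Strict linearity of the word orders, and leading words\<close>

lemma mlex_iff_lexord: "mlex lt \<alpha> \<beta> \<longleftrightarrow> (rev \<alpha>, rev \<beta>) \<in> lexord {(x, y). lt x y}"
proof -
  have 1: "(\<exists>\<eta>. \<eta> \<noteq> [] \<and> \<beta> = \<eta> @ \<alpha>) \<longleftrightarrow> (\<exists>a v. rev \<beta> = rev \<alpha> @ a # v)"
  proof
    assume "\<exists>\<eta>. \<eta> \<noteq> [] \<and> \<beta> = \<eta> @ \<alpha>"
    then obtain \<eta> where "\<eta> \<noteq> []" "\<beta> = \<eta> @ \<alpha>" by blast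
    then show "\<exists>a v. rev \<beta> = rev \<alpha> @ a # v"
      by (cases \<eta> rule: rev_cases) auto
  next
    assume "\<exists>a v. rev \<beta> = rev \<alpha> @ a # v"
    then obtain a v where "rev \<beta> = rev \<alpha> @ a # v" by blast
    then have "\<beta> = (rev v @ [a]) @ \<alpha>" by (simp add: rev_eq_append_conv)
    then show "\<exists>\<eta>. \<eta> \<noteq> [] \<and> \<beta> = \<eta> @ \<alpha>" by blast
  qed
  have 2: "(\<exists>\<eta> \<zeta> \<gamma> x y. \<alpha> = \<eta> @ [x] @ \<gamma> \<and> \<beta> = \<zeta> @ [y] @ \<gamma> \<and> lt x y) \<longleftrightarrow>
    (\<exists>u a b v w. lt a b \<and> rev \<alpha> = u @ a # v \<and> rev \<beta> = u @ b # w)"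
  proof
    assume "\<exists>\<eta> \<zeta> \<gamma> x y. \<alpha> = \<eta> @ [x] @ \<gamma> \<and> \<beta> = \<zeta> @ [y] @ \<gamma> \<and> lt x y"
    then obtain \<eta> \<zeta> \<gamma> x y where "\<alpha> = \<eta> @ [x] @ \<gamma>" "\<beta> = \<zeta> @ [y] @ \<gamma>" "lt x y" by blast
    then show "\<exists>u a b v w. lt a b \<and> rev \<alpha> = u @ a # v \<and> rev \<beta> = u @ b # w"
      by (intro exI[of _ "rev \<gamma>"] exI[of _ x] exI[of _ y] exI[of _ "rev \<eta>"] exI[of _ "rev \<zeta>"]) simp
  next
    assume "\<exists>u a b v w. lt a b \<and> rev \<alpha> = u @ a # v \<and> rev \<beta> = u @ b # w"
    then obtain u a b v w where "lt a b" "rev \<alpha> = u @ a # v" "rev \<beta> = u @ b # w" by blast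
    then show "\<exists>\<eta> \<zeta> \<gamma> x y. \<alpha> = \<eta> @ [x] @ \<gamma> \<and> \<beta> = \<zeta> @ [y] @ \<gamma> \<and> lt x y"
      by (intro exI[of _ "rev v"] exI[of _ "rev w"] exI[of _ "rev u"] exI[of _ a] exI[of _ b])
        (simp add: rev_eq_append_conv)
  qed
  show ?thesis
    unfolding mlex_def 1 2 lexord_def by simp
qed

lemma lexord_total_on:
  assumes "\<And>x y. x \<in> S \<Longrightarrow> y \<in> S \<Longrightarrow> (x, y) \<in> r \<or> x = y \<or> (y, x) \<in> r"
  shows "set u \<subseteq> S \<Longrightarrow> set v \<subseteq> S \<Longrightarrow> (u, v) \<in> lexord r \<or> u = v \<or> (v, u) \<in> lexord r"
proof (induction u arbitrary: v)
  case Nil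
  then show ?case by (cases v) auto
next
  case (Cons x u)
  then show ?case using assms[of x] by (cases v) auto
qed

text \<open>Only totality is relative to \<open>S\<close>; irreflexivity and transitivity hold on
  the whole type and so can be applied without membership conditions.\<close>

definition strict_linear_on :: "'a set \<Rightarrow> ('a \<Rightarrow> 'a \<Rightarrow> bool) \<Rightarrow> bool" where
  "strict_linear_on S lt \<longleftrightarrow> (\<forall>x. \<not> lt x x) \<and> (\<forall>x y z. lt x y \<longrightarrow> lt y z \<longrightarrow> lt x z) \<and>
    (\<forall>x\<in>S. \<forall>y\<in>S. lt x y \<or> x = y \<or> lt y x)"

lemma strict_linear_on_mlex:
  assumes "strict_linear_on S lt"
  shows "strict_linear_on (lists S) (mlex lt)"
proof -
  let ?r = "{(x, y). lt x y}"
  have trans: "trans ?r"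
    using assms unfolding strict_linear_on_def trans_def by blast
  have "(x, x) \<notin> lexord ?r" for x
    using assms by (intro lexord_irreflexive) (auto simp: strict_linear_on_def)
  moreover have "(x, z) \<in> lexord ?r" if "(x, y) \<in> lexord ?r" "(y, z) \<in> lexord ?r" for x y z
    using that trans by (rule lexord_trans)
  moreover have "(rev x, rev y) \<in> lexord ?r \<or> x = y \<or> (rev y, rev x) \<in> lexord ?r"
    if "x \<in> lists S" "y \<in> lists S" for x y
    using assms that lexord_total_on[of S ?r "rev x" "rev y"] by (auto simp: strict_linear_on_def)
  ultimately show ?thesis
    unfolding strict_linear_on_def mlex_iff_lexord by blast
qed

lemma strict_linear_on_less_Ow:
  assumes "strict_linear_on S lt"
  shows "strict_linear_on (lists S) (less_Ow lt)"
proof -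
  have lt: "\<not> lt x x" "lt x y \<Longrightarrow> lt y z \<Longrightarrow> lt x z" "x \<in> S \<Longrightarrow> y \<in> S \<Longrightarrow> lt x y \<or> x = y \<or> lt y x" for x y z
    using assms unfolding strict_linear_on_def by blast+
  have ml: "\<not> mlex lt x x" "mlex lt x y \<Longrightarrow> mlex lt y z \<Longrightarrow> mlex lt x z"
    "x \<in> lists S \<Longrightarrow> y \<in> lists S \<Longrightarrow> mlex lt x y \<or> x = y \<or> mlex lt y x" for x y z
    using strict_linear_on_mlex[OF assms] unfolding strict_linear_on_def by blast+
  have "less_Ow lt x z" if "less_Ow lt x y" "less_Ow lt y z" for x y z
  proof -
    have "lt (last x) (last y) \<longrightarrow> lt (last y) (last z) \<longrightarrow> lt (last x) (last z)"
      using lt(2) by blast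
    with that ml(2)[of x y z] show ?thesis unfolding less_Ow_def by auto
  qed
  moreover have "less_Ow lt x y \<or> x = y \<or> less_Ow lt y x" if "x \<in> lists S" "y \<in> lists S" for x y
  proof (cases "x = [] \<or> y = []")
    case False
    then have "last x \<in> S" "last y \<in> S" using that by (auto simp: in_lists_conv_set)
    then show ?thesis using False lt(3)[of "last x" "last y"] ml(3)[OF that] unfolding less_Ow_def
      by (metis linorder_neqE_nat)
  qed (auto simp: less_Ow_def)
  moreover have "\<not> less_Ow lt x x" for x
    using lt ml by (auto simp: less_Ow_def)
  ultimately show ?thesis unfolding strict_linear_on_def by blast
qed

lemma strict_linear_on_less_Xw:
  assumes ord: "\<And>n. well_order_on {y \<in> Os. t y = n} (ord n)"
  shows "strict_linear_on (lists (letters Os t)) (less_Xw t (less_O t ord))"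
proof -
  have "strict_linear_on Os (less_O t ord)"
    using less_O_irrefl[OF ord] less_O_trans[OF ord] less_O_total[OF ord]
    unfolding strict_linear_on_def by blast
  note Ow = strict_linear_on_less_Ow[OF this]
  have "strict_linear_on (letters Os t) (less_X t (less_O t ord))"
    using less_X_irrefl[OF ord] less_X_trans[OF ord] less_X_total[OF ord]
    unfolding strict_linear_on_def by blast
  note ml = strict_linear_on_mlex[OF this]
  have C: "map C w \<in> lists Os" if "w \<in> lists (letters Os t)" for w
    using that by (auto simp: in_lists_conv_set letters_def)
  show ?thesis
    unfolding strict_linear_on_def
  proof (intro conjI allI ballI impI)
    show "\<not> less_Xw t (less_O t ord) x x" for x
      using Ow ml by (simp add: strict_linear_on_def less_Xw_def)
    show "less_Xw t (less_O t ord) x z"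
      if "less_Xw t (less_O t ord) x y" "less_Xw t (less_O t ord) y z" for x y z
    proof -
      have "less_Ow (less_O t ord) (map C x) (map C y) \<Longrightarrow> less_Ow (less_O t ord) (map C y) (map C z) \<Longrightarrow>
          less_Ow (less_O t ord) (map C x) (map C z)"
        using Ow unfolding strict_linear_on_def by blast
      moreover have "mlex (less_X t (less_O t ord)) x y \<Longrightarrow> mlex (less_X t (less_O t ord)) y z \<Longrightarrow>
          mlex (less_X t (less_O t ord)) x z"
        using ml unfolding strict_linear_on_def by blast
      ultimately show ?thesis using that unfolding less_Xw_def by auto
    qed
    show "less_Xw t (less_O t ord) x y \<or> x = y \<or> less_Xw t (less_O t ord) y x"
      if "x \<in> lists (letters Os t)" "y \<in> lists (letters Os t)" for x y
    proof -
      have "less_Ow (less_O t ord) (map C x) (map C y) \<or> map C x = map C y \<or> less_Ow (less_O t ord) (map C y) (map C x)"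
        using Ow C[OF that(1)] C[OF that(2)] unfolding strict_linear_on_def by blast
      moreover have "mlex (less_X t (less_O t ord)) x y \<or> x = y \<or> mlex (less_X t (less_O t ord)) y x"
        using ml that unfolding strict_linear_on_def by blast
      ultimately show ?thesis unfolding less_Xw_def by auto
    qed
  qed
qed

text \<open>A finite non-empty support has a greatest word, and linearity makes it unique, so the
  definite description in \<open>LW\<close> denotes it.\<close>

lemma LW_mem:
  assumes lin: "strict_linear_on D lt" and keys: "Poly_Mapping.keys p \<subseteq> D" and "p \<noteq> 0"
  shows "LW lt p \<in> Poly_Mapping.keys p \<and> (\<forall>v\<in>Poly_Mapping.keys p. v \<noteq> LW lt p \<longrightarrow> lt v (LW lt p))"
proof -
  have "\<exists>w\<in>S. \<forall>v\<in>S. v \<noteq> w \<longrightarrow> lt v w" if "finite S" "S \<noteq> {}" "S \<subseteq> D" for S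
    using that
  proof (induction S rule: finite_ne_induct)
    case (insert x S)
    then obtain w where "w \<in> S" "\<forall>v\<in>S. v \<noteq> w \<longrightarrow> lt v w" by blast
    moreover have "x \<in> D" "w \<in> D" "x \<noteq> w" using insert \<open>w \<in> S\<close> by auto
    moreover from this have "lt x w \<or> lt w x"
      using lin unfolding strict_linear_on_def by blast
    moreover have "lt v x" if "lt v w" "lt w x" for v
      using lin that unfolding strict_linear_on_def by blast
    ultimately show ?case by (metis insert_iff)
  qed simp
  from this[of "Poly_Mapping.keys p"] assms
  obtain w where w: "w \<in> Poly_Mapping.keys p" "\<forall>v\<in>Poly_Mapping.keys p. v \<noteq> w \<longrightarrow> lt v w"
    by auto
  have "LW lt p = w"
    unfolding LW_def using w lin by (intro the_equality) (auto simp: strict_linear_on_def, metis)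
  with w show ?thesis by simp
qed

section \<open>The adjoint action\<close>

lemma subalgebra_hull:
  assumes "vector_space s"
  shows "subalgebra s (subalgebra s hull S)"
proof -
  interpret vector_space s by fact
  show ?thesis
    by (rule hull_in) (auto simp: subalgebra_def intro: subspace_Inter)
qed

context hopf_algebra
begin

definition ad :: "'h \<Rightarrow> 'h \<Rightarrow> 'h" where
  "ad b h = lin_ext scale (\<lambda>(u, v). u * h * antipode v) (comult b)"

lemma bilinear_ad: "bilinear_map scale scale scale (\<lambda>u v. u * h * antipode v)"
  by (simp add: bilinear_map_def algebra_rules)

lemma ad_add: "ad (x + y) h = ad x h + ad y h" and ad_scale: "ad (scale c x) h = scale c (ad x h)"
  using linear_lin_ext_comult[OF bilinear_ad] by (simp_all add: ad_def Vector_Spaces.linear_iff)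

lemma ad_one: "ad 1 h = h"
  unfolding ad_def using lin_ext_tensor_eq[OF vector_space_axioms bilinear_ad comult_one, of h]
  by (simp add: lin_ext_simps antipode_one)

text \<open>For a letter \<open>y\<close> the symbol \<open>y\<^sub>a\<close> stands for \<open>ad a y\<close>, so this identity moves elements of the
  Hopf coradical to the right of the letters of positive degree.\<close>

lemma mult_eq_ad: "b * h = lin_ext scale (\<lambda>(u, v). ad u h * v) (comult b)"
proof -
  \<comment> \<open>Contracting coassociativity with \<open>\<tau>\<close>, the left bracketing
    yields the adjoint action followed by multiplication, while in the right bracketing the last two
    factors collapse to a counit by \<open>antipode_left\<close>.\<close>
  define \<tau> where "\<tau> a b c = a * h * antipode b * c" for a b c
  let ?L = "lin_ext fscale (\<lambda>(a, c). lin_ext fscale (\<lambda>(a', b). Poly_Mapping.single (a', b, c) (1::'k)) (comult a)) (comult b)"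
  let ?R = "lin_ext fscale (\<lambda>(a, c). lin_ext fscale (\<lambda>(b, c'). Poly_Mapping.single (a, b, c') (1::'k)) (comult c)) (comult b)"
  have "lin_ext scale (\<lambda>(a, b, c). \<tau> a b c) (?L - ?R) = 0"
    using coassoc
    by (intro lin_ext_tensor3_null[OF vector_space_axioms])
      (auto simp: \<tau>_def Vector_Spaces.linear_iff vector_space_axioms algebra_rules)
  then have "lin_ext scale (\<lambda>(a, b, c). \<tau> a b c) ?L = lin_ext scale (\<lambda>(a, b, c). \<tau> a b c) ?R"
    by (simp add: lin_ext_diff[OF vector_space_axioms])
  moreover have "lin_ext scale (\<lambda>(a, b, c). \<tau> a b c) ?L = lin_ext scale (\<lambda>(u, v). ad u h * v) (comult b)"
    unfolding lin_ext_compose[OF vector_space_axioms] split_def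
    by (simp add: lin_ext_simps \<tau>_def)
      (simp add: ad_def lin_ext_def split_def sum_distrib_right scale_mult_left)
  moreover have "lin_ext scale (\<lambda>(a, b, c). \<tau> a b c) ?R = b * h"
  proof -
    have "lin_ext scale (\<lambda>(a, b, c). \<tau> a b c) ?R =
        lin_ext scale (\<lambda>(a, c). a * h * lin_ext scale (\<lambda>(b', c'). antipode b' * c') (comult c)) (comult b)"
      unfolding lin_ext_compose[OF vector_space_axioms] split_def
      by (simp add: lin_ext_simps \<tau>_def)
        (simp add: lin_ext_def split_def sum_distrib_left scale_mult_right mult.assoc)
    also have "\<dots> = lin_ext scale (\<lambda>(a, c). scale (counit c) a * h) (comult b)"
      by (simp add: antipode_left scale_mult_left scale_mult_right)
    also have "\<dots> = lin_ext scale (\<lambda>(a, c). scale (counit c) a) (comult b) * h"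
      by (simp add: lin_ext_def split_def sum_distrib_right scale_mult_left)
    finally show ?thesis by (simp add: counit_right)
  qed
  ultimately show ?thesis by simp
qed

lemma bilinear_ad_mult: "bilinear_map scale scale scale (\<lambda>u v. ad u h * v)"
  by (simp add: bilinear_map_def algebra_rules ad_add ad_scale)

section \<open>Coproducts with factors in prescribed subspaces\<close>

lemma subspace_tensor_null: "fscale.subspace (tensor_null s1 s2)"
  unfolding tensor_null_def by (rule fscale.subspace_span)

lemma tensor_sub_tensor_eq:
  assumes "T' \<in> tensor_sub s1 s2 U V" "tensor_eq s1 s2 T T'"
  shows "T \<in> tensor_sub s1 s2 U V"
proof -
  obtain T'' where T'': "Poly_Mapping.keys T'' \<subseteq> U \<times> V" "tensor_eq s1 s2 T' T''"
    using assms(1) by (auto simp: tensor_sub_def)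
  have "(T - T') + (T' - T'') \<in> tensor_null s1 s2"
    using assms(2) T'' by (intro fscale.subspace_add[OF subspace_tensor_null]) (auto simp: tensor_eq_def)
  with T'' show ?thesis by (auto simp: tensor_sub_def tensor_eq_def)
qed

lemma tensor_sub_add_scale:
  assumes "T \<in> tensor_sub s1 s2 U V" "T' \<in> tensor_sub s1 s2 U V"
  shows "fscale c T + T' \<in> tensor_sub s1 s2 U V"
proof -
  obtain R where R: "Poly_Mapping.keys R \<subseteq> U \<times> V" "T - R \<in> tensor_null s1 s2"
    using assms(1) by (auto simp: tensor_sub_def tensor_eq_def)
  obtain R' where R': "Poly_Mapping.keys R' \<subseteq> U \<times> V" "T' - R' \<in> tensor_null s1 s2"
    using assms(2) by (auto simp: tensor_sub_def tensor_eq_def)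
  have "fscale c (T - R) + (T' - R') \<in> tensor_null s1 s2"
    using R R' by (intro fscale.subspace_add[OF subspace_tensor_null] fscale.subspace_scale[OF subspace_tensor_null])
  then have "(fscale c T + T') - (fscale c R + R') \<in> tensor_null s1 s2"
    by (simp add: fscale.scale_right_diff_distrib algebra_simps)
  moreover have "Poly_Mapping.keys (fscale c R + R') \<subseteq> U \<times> V"
  proof (rule order_trans[OF keys_add], rule Un_least)
    have "Poly_Mapping.keys (fscale c R) \<subseteq> Poly_Mapping.keys R" by (auto simp: in_keys_iff)
    then show "Poly_Mapping.keys (fscale c R) \<subseteq> U \<times> V" using R(1) by blast
  qed (fact R'(1))
  ultimately show ?thesis by (auto simp: tensor_sub_def tensor_eq_def)
qed

lemma comult_span:
  assumes "h \<in> span S" "\<And>x. x \<in> S \<Longrightarrow> comult x \<in> tensor_sub scale scale U V"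
  shows "comult h \<in> tensor_sub scale scale U V"
  using assms(1)
proof (induction rule: span_induct_alt)
  case base
  have "tensor_eq scale scale (comult 0) 0"
    using comult_scale[of 0 0] by simp
  then show ?case unfolding tensor_sub_def by (intro CollectI exI[of _ 0]) simp
next
  case (step c x y)
  have "fscale c (comult x) + comult y \<in> tensor_sub scale scale U V"
    by (intro tensor_sub_add_scale step assms(2))
  moreover have "(comult (scale c x + y) - (comult (scale c x) + comult y)) + (comult (scale c x) - fscale c (comult x))
      \<in> tensor_null scale scale"
    using comult_add comult_scale unfolding tensor_eq_def
    by (intro fscale.subspace_add[OF subspace_tensor_null])
  ultimately show ?case
    by (elim tensor_sub_tensor_eq) (simp add: tensor_eq_def algebra_simps)
qed

end

lemma keys_free_tensor: "Poly_Mapping.keys (free_tensor p q) \<subseteq> Poly_Mapping.keys p \<times> Poly_Mapping.keys q"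
proof
  fix z assume "z \<in> Poly_Mapping.keys (free_tensor p q)"
  then show "z \<in> Poly_Mapping.keys p \<times> Poly_Mapping.keys q"
    by (cases z) (auto simp: in_keys_iff)
qed

lemma keys_sum_list:
  "(\<And>x. x \<in> set xs \<Longrightarrow> Poly_Mapping.keys (g x) \<subseteq> K) \<Longrightarrow> Poly_Mapping.keys (\<Sum>x\<leftarrow>xs. g x) \<subseteq> K"
proof (induction xs)
  case (Cons x xs)
  then show ?case using keys_add[of "g x" "\<Sum>x\<leftarrow>xs. g x"] by auto
qed simp

text \<open>Letters of degree zero weigh nothing, so moving them past other letters of a word leaves
  the weight unchanged.\<close>

definition weight :: "('o \<Rightarrow> nat) \<Rightarrow> 'o letter list \<Rightarrow> nat" where
  "weight t w = (\<Sum>x\<leftarrow>w. t (C x))"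

lemma weight_simps [simp]:
  "weight t [] = 0" "weight t (x # w) = t (C x) + weight t w" "weight t (u @ v) = weight t u + weight t v"
  by (simp_all add: weight_def)

section \<open>Words\<close>

context hopf_framework
begin

abbreviation "X \<equiv> letters Os t"
abbreviation "X0 \<equiv> letters0 Os t"
abbreviation "Xp \<equiv> letters_plus Os t"
abbreviation "lt \<equiv> less_O t ord"
abbreviation "ltX \<equiv> less_X t lt"
abbreviation "HB \<equiv> hopf_coradical scale comult"
abbreviation "L \<equiv> letter_map scale comult antipode f"

definition P :: "'o letter list \<Rightarrow> 'h" where "P w = prod_list (map L w)"

lemma P_simps [simp]: "P [] = 1" "P (x # w) = L x * P w" "P (u @ v) = P u * P v"
  by (simp_all add: P_def)

lemma free_alg_hom_eq: "free_alg_hom scale L p = lin_ext scale P p"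
  by (simp add: free_alg_hom_def P_def[abs_def])

lemma X_split: "X = X0 \<union> Xp" and X0_X: "X0 \<subseteq> X" and Xp_X: "Xp \<subseteq> X"
  by (auto simp: letters0_def letters_plus_def)

lemma X0_eq: "X0 = Plain ` {y \<in> Os. t y = 0}"
  by (auto simp: letters0_def letters_def)

lemma single_mem: "w \<in> lists X \<Longrightarrow> Poly_Mapping.single w (1::'k) \<in> free_algebra X"
  by (simp add: free_algebra_def)

lemma \<Delta>_Nil: "\<Delta> (Poly_Mapping.single [] 1) = Poly_Mapping.single ([], []) 1"
proof -
  have "Poly_Mapping.single ([] :: 'o letter list) (1::'k) = 1"
    "Poly_Mapping.single ([] :: 'o letter list, [] :: 'o letter list) (1::'k) = 1"
    using single_one[where ?'a = "'o letter list" and ?'b = 'k]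
      single_one[where ?'a = "'o letter list \<times> 'o letter list" and ?'b = 'k]
    by (simp_all add: zero_list_def zero_prod_def)
  then show ?thesis using \<Delta>_hom by (simp add: free_comult_hom_def)
qed

lemma \<Delta>_Cons:
  assumes "x \<in> X" "w \<in> lists X"
  shows "\<Delta> (Poly_Mapping.single (x # w) 1) = \<Delta> (Poly_Mapping.single [x] 1) * \<Delta> (Poly_Mapping.single w 1)"
proof -
  have "Poly_Mapping.single (x # w) (1::'k) = Poly_Mapping.single [x] 1 * Poly_Mapping.single w 1"
    by (simp add: mult_single plus_list_def)
  then show ?thesis
    using \<Delta>_hom single_mem[of "[x]"] single_mem[of w] assms by (simp add: free_comult_hom_def)
qed

lemma tensor_eq_comult_P:
  assumes "w \<in> lists X"
  shows "tensor_eq scale scale (comult (P w))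
    (lin_ext fscale (\<lambda>(u, v). Poly_Mapping.single (P u, P v) 1) (\<Delta> (Poly_Mapping.single w 1)))"
  using \<Delta>_compat[OF single_mem[OF assms]]
  by (simp add: free_alg_hom_eq lin_ext_simps)

lemma comult_P_mem:
  assumes w: "w \<in> lists X" and keys: "Poly_Mapping.keys (\<Delta> (Poly_Mapping.single w 1)) \<subseteq> U \<times> V"
    and UV: "P ` U \<subseteq> U'" "P ` V \<subseteq> V'"
  shows "comult (P w) \<in> tensor_sub scale scale U' V'"
proof -
  let ?T = "lin_ext fscale (\<lambda>(u, v). Poly_Mapping.single (P u, P v) 1) (\<Delta> (Poly_Mapping.single w 1))"
  have "Poly_Mapping.keys ?T \<subseteq> U' \<times> V'"
    unfolding lin_ext_def
  proof (rule order_trans[OF keys_sum], rule UN_least, clarify)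
    fix u v a b
    assume "(u, v) \<in> Poly_Mapping.keys (\<Delta> (Poly_Mapping.single w 1))"
      "(a, b) \<in> Poly_Mapping.keys (fscale (Poly_Mapping.lookup (\<Delta> (Poly_Mapping.single w 1)) (u, v))
        (Poly_Mapping.single (P u, P v) 1))"
    with keys UV show "a \<in> U' \<and> b \<in> V'"
      by (auto simp: fscale_single split: if_splits)
  qed
  with tensor_eq_comult_P[OF w] show ?thesis by (auto simp: tensor_sub_def)
qed

lemma hit_P_eq:
  assumes "functional \<chi>" "w \<in> lists X"
  shows "hit \<chi> (P w) = lin_ext scale (\<lambda>(u, v). scale (\<chi> (P v)) (P u)) (\<Delta> (Poly_Mapping.single w 1))"
  unfolding hit_tensor_eq[OF assms(1) tensor_eq_comult_P[OF assms(2)]] lin_ext_compose[OF vector_space_axioms]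
  by (simp add: split_def lin_ext_simps)

text \<open>Since \<open>\<Delta>\<close> is multiplicative, it is enough to control letters. With
  \<open>Z = X0\<close> this gives the coproduct on the Hopf coradical, with the letters below a
  class the coideal property of \<open>A\<close>.\<close>

lemma keys_\<Delta>_word:
  assumes Z: "Z \<subseteq> X" and letter: "\<And>x. x \<in> Z \<Longrightarrow>
      Poly_Mapping.keys (\<Delta> (Poly_Mapping.single [x] 1)) \<subseteq> lists U \<times> lists V"
  shows "w \<in> lists Z \<Longrightarrow> Poly_Mapping.keys (\<Delta> (Poly_Mapping.single w 1)) \<subseteq> lists U \<times> lists V"
proof (induction w)
  case Nil
  show ?case by (simp add: \<Delta>_Nil)
next
  case (Cons x w)
  have "Poly_Mapping.keys (\<Delta> (Poly_Mapping.single (x # w) 1)) \<subseteq>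
      {a + b | a b. a \<in> Poly_Mapping.keys (\<Delta> (Poly_Mapping.single [x] 1)) \<and>
        b \<in> Poly_Mapping.keys (\<Delta> (Poly_Mapping.single w 1))}"
  proof -
    have "x \<in> X" "w \<in> lists X" using Cons.prems Z by auto
    then show ?thesis by (simp only: \<Delta>_Cons keys_mult)
  qed
  also have "\<dots> \<subseteq> lists U \<times> lists V"
    using letter[of x] Cons by (fastforce simp: plus_prod_def plus_list_def)
  finally show ?case .
qed

lemma keys_\<Delta>_X0_letter:
  assumes "x \<in> X0"
  shows "Poly_Mapping.keys (\<Delta> (Poly_Mapping.single [x] 1)) \<subseteq> lists X0 \<times> lists X0"
proof -
  obtain r ts where r: "r \<in> letter_span X0"
    and ts: "\<And>x' q. (x', q) \<in> set ts \<Longrightarrow> x' \<in> X0 \<and> q \<in> letter_span X0"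
    and eq: "\<Delta> (Poly_Mapping.single [x] 1) =
        free_tensor (Poly_Mapping.single [x] 1) (1 - r) + free_tensor 1 (Poly_Mapping.single [x] 1)
        + (\<Sum>(x', q)\<leftarrow>ts. free_tensor (Poly_Mapping.single [x'] 1) q)"
    using \<Delta>_skew assms unfolding skew_triangular_def by fast
  let ?K = "lists X0 \<times> lists X0"
  have span: "Poly_Mapping.keys q \<subseteq> lists X0" if "q \<in> letter_span X0" for q :: "'o letter list \<Rightarrow>\<^sub>0 'k"
    using that by (auto simp: letter_span_def)
  have "Poly_Mapping.keys (1 - r) \<subseteq> lists X0"
    using span[OF r] by (intro order_trans[OF keys_diff]) (auto simp: zero_list_def)
  then have "Poly_Mapping.keys (free_tensor (Poly_Mapping.single [x] 1) (1 - r)) \<subseteq> ?K"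
    using assms by (intro order_trans[OF keys_free_tensor]) auto
  moreover have "Poly_Mapping.keys (free_tensor 1 (Poly_Mapping.single [x] (1::'k))) \<subseteq> ?K"
    using assms by (intro order_trans[OF keys_free_tensor]) (auto simp: zero_list_def)
  moreover have "Poly_Mapping.keys (\<Sum>(x', q)\<leftarrow>ts. free_tensor (Poly_Mapping.single [x'] 1) q) \<subseteq> ?K"
  proof (rule keys_sum_list, clarify)
    fix x' q a b
    assume "(x', q) \<in> set ts" "(a, b) \<in> Poly_Mapping.keys (free_tensor (Poly_Mapping.single [x'] 1) q)"
    then show "a \<in> lists X0 \<and> b \<in> lists X0"
      using ts[of x' q] span[of q] keys_free_tensor[of "Poly_Mapping.single [x'] 1" q] by auto
  qed
  ultimately show ?thesis
    unfolding eq by (intro order_trans[OF keys_add] Un_least)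
qed

text \<open>\<open>R\<close> collects the mixed summands of skew-triangularity. Their left factors
  \<open>u\<close> are bounded in two ways: the weight bound drives the filtration, and the bound on
  classes puts \<open>P u\<close> into the subalgebra generated by lower classes. The
  \<open>X0\<close> part of \<open>u\<close> satisfies both, having degree zero while
  \<open>x\<close> has positive degree.\<close>

lemma \<Delta>_Xp_letter:
  assumes "x \<in> Xp"
  obtains R where "\<Delta> (Poly_Mapping.single [x] 1) =
      Poly_Mapping.single ([x], []) 1 + Poly_Mapping.single ([], [x]) 1 + R"
    "Poly_Mapping.keys R \<subseteq> {u \<in> lists X. weight t u < t (C x) \<and> (\<forall>y\<in>set u. lt (C y) (C x))} \<times> lists X"
proof -
  obtain ts where ts: "\<And>u v q. (u, v, q) \<in> set ts \<Longrightarrow>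
        (u = [] \<or> (\<exists>z\<in>Xp. u = [z] \<and> t (C z) < t (C x) \<and> lt (C z) (C x))) \<and>
        (v = [] \<or> (\<exists>a\<in>X0. v = [a])) \<and> q \<in> free_algebra_plus X"
    and eq: "\<Delta> (Poly_Mapping.single [x] 1) =
        free_tensor (Poly_Mapping.single [x] 1) 1 + free_tensor 1 (Poly_Mapping.single [x] 1)
        + (\<Sum>(u, v, q)\<leftarrow>ts. free_tensor (Poly_Mapping.single (u @ v) 1) q)"
    using \<Delta>_skew assms unfolding skew_triangular_def by fast
  have single: "free_tensor (Poly_Mapping.single u 1) (Poly_Mapping.single v 1) = Poly_Mapping.single (u, v) (1::'k)"
    for u v :: "'o letter list"
    by (rule poly_mapping_eqI) (auto simp: lookup_single when_def split: if_splits)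
  have one: "(1 :: 'o letter list \<Rightarrow>\<^sub>0 'k) = Poly_Mapping.single [] 1"
    unfolding single_one[symmetric] by (simp add: zero_list_def)
  let ?K = "{u \<in> lists X. weight t u < t (C x) \<and> (\<forall>y\<in>set u. lt (C y) (C x))} \<times> lists X"
  have K: "u @ v \<in> {u \<in> lists X. weight t u < t (C x) \<and> (\<forall>y\<in>set u. lt (C y) (C x))}"
    if "(u, v, q) \<in> set ts" for u v q
    using ts[OF that] assms X0_X Xp_X by (auto simp: letters_plus_def letters0_def less_O_def)
  have "Poly_Mapping.keys (\<Sum>(u, v, q)\<leftarrow>ts. free_tensor (Poly_Mapping.single (u @ v) 1) q) \<subseteq> ?K"
  proof (rule keys_sum_list)
    fix z assume z: "z \<in> set ts"
    obtain u v q where zz: "z = (u, v, q)" by (cases z)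
    have "q \<in> free_algebra_plus X" using ts[of u v q] z zz by auto
    then have "Poly_Mapping.keys q \<subseteq> lists X" unfolding free_algebra_plus_def by blast
    then show "Poly_Mapping.keys (case z of (u, v, q) \<Rightarrow> free_tensor (Poly_Mapping.single (u @ v) 1) q) \<subseteq> ?K"
      using K[of u v q] z keys_free_tensor[of "Poly_Mapping.single (u @ v) 1" q]
      unfolding zz by fastforce
  qed
  then show ?thesis
    using that eq unfolding one single by blast
qed

text \<open>When the product of the coproducts of the letters is expanded, every summand other than
  \<open>w \<otimes> 1\<close> loses weight on the left at some letter. The terms
  \<open>1 \<otimes> x\<close> are included because all degrees are positive.\<close>

lemma keys_\<Delta>_weight:
  "w \<in> lists Xp \<Longrightarrow>
    Poly_Mapping.keys (\<Delta> (Poly_Mapping.single w 1) - Poly_Mapping.single (w, []) 1)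
      \<subseteq> {u \<in> lists X. weight t u < weight t w} \<times> lists X"
proof (induction w)
  case Nil
  show ?case by (simp add: \<Delta>_Nil)
next
  case (Cons x w)
  then have x: "x \<in> Xp" "w \<in> lists Xp" by auto
  then have x': "x \<in> X" "w \<in> lists X" using Xp_X by auto
  obtain R where R: "\<Delta> (Poly_Mapping.single [x] 1) =
      Poly_Mapping.single ([x], []) 1 + Poly_Mapping.single ([], [x]) 1 + R"
    "Poly_Mapping.keys R \<subseteq> {u \<in> lists X. weight t u < t (C x) \<and> (\<forall>y\<in>set u. lt (C y) (C x))} \<times> lists X"
    by (rule \<Delta>_Xp_letter[OF x(1)])
  define R1 where "R1 = Poly_Mapping.single ([], [x]) 1 + R"
  define R2 where "R2 = \<Delta> (Poly_Mapping.single w 1) - Poly_Mapping.single (w, []) 1"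
  let ?S1 = "Poly_Mapping.single ([x], []) (1::'k)" and ?S2 = "Poly_Mapping.single (w, []) (1::'k)"
  let ?K = "{u \<in> lists X. weight t u < weight t (x # w)} \<times> lists X"
  have keysR1: "Poly_Mapping.keys R1 \<subseteq> {u \<in> lists X. weight t u < t (C x)} \<times> lists X"
    unfolding R1_def using R(2) x(1) x'
    by (intro order_trans[OF keys_add] Un_least) (auto simp: letters_plus_def)
  have keysR2: "Poly_Mapping.keys R2 \<subseteq> {u \<in> lists X. weight t u < weight t w} \<times> lists X"
    unfolding R2_def by (rule Cons.IH[OF x(2)])
  have "\<Delta> (Poly_Mapping.single (x # w) 1) = (?S1 + R1) * (?S2 + R2)"
    unfolding \<Delta>_Cons[OF x'] R(1) by (simp add: R1_def R2_def add.assoc)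
  also have "\<dots> = Poly_Mapping.single (x # w, []) 1 + (?S1 * R2 + R1 * ?S2 + R1 * R2)"
    by (simp add: distrib_left distrib_right mult_single plus_list_def plus_prod_def)
  finally have "\<Delta> (Poly_Mapping.single (x # w) 1) - Poly_Mapping.single (x # w, []) 1 =
    ?S1 * R2 + R1 * ?S2 + R1 * R2" by simp
  moreover have "Poly_Mapping.keys (?S1 * R2) \<subseteq> ?K"
    using keysR2 x' by (intro order_trans[OF keys_mult]) (fastforce simp: plus_list_def plus_prod_def)
  moreover have "Poly_Mapping.keys (R1 * ?S2) \<subseteq> ?K"
    using keysR1 x' by (intro order_trans[OF keys_mult]) (fastforce simp: plus_list_def plus_prod_def)
  moreover have "Poly_Mapping.keys (R1 * R2) \<subseteq> ?K"
    using keysR1 keysR2 by (intro order_trans[OF keys_mult]) (fastforce simp: plus_list_def plus_prod_def)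
  ultimately show ?case
    by (simp only:) (intro order_trans[OF keys_add] Un_least)
qed

section \<open>Normal form of words: letters of positive degree first\<close>

lemma subalgebra_HB: "subalgebra scale HB"
  unfolding hopf_coradical_def by (rule subalgebra_hull[OF vector_space_axioms])

lemma HB_simps: "subspace HB" "1 \<in> HB" "x \<in> HB \<Longrightarrow> y \<in> HB \<Longrightarrow> x * y \<in> HB"
  using subalgebra_HB by (auto simp: subalgebra_def)

lemma f_image_span: "span (f ` {y \<in> Os. t y = 0}) = {h \<in> HB. counit h = 0}"
  using basis by (auto simp: bij_betw_def)

lemma f_HB: "y \<in> Os \<Longrightarrow> t y = 0 \<Longrightarrow> f y \<in> HB"
  using f_image_span span_superset[of "f ` {y \<in> Os. t y = 0}"] by blast

lemma HB_span:
  assumes "b \<in> HB"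
  shows "b \<in> span (insert 1 (f ` {y \<in> Os. t y = 0}))"
proof -
  have "counit (b - scale (counit b) 1) = 0"
  proof -
    have "counit b = counit (b - scale (counit b) 1) + counit (scale (counit b) 1)"
      using functional_counit unfolding functional_def by (metis diff_add_cancel)
    also have "counit (scale (counit b) 1) = counit b"
      using functional_counit by (simp add: functional_def counit_one)
    finally show ?thesis by simp
  qed
  then have "b - scale (counit b) 1 \<in> span (f ` {y \<in> Os. t y = 0})"
    unfolding f_image_span using assms HB_simps by (auto intro: subspace_diff subspace_scale)
  then have "b - scale (counit b) 1 \<in> span (insert 1 (f ` {y \<in> Os. t y = 0}))"
    using span_mono[of "f ` {y \<in> Os. t y = 0}"] by blast
  moreover have "scale (counit b) 1 \<in> span (insert 1 (f ` {y \<in> Os. t y = 0}))"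
    by (intro span_scale span_base) simp
  ultimately show ?thesis using span_add by fastforce
qed

lemma P_mem_HB: "w \<in> lists X0 \<Longrightarrow> P w \<in> HB"
  by (induction w) (auto simp: HB_simps X0_eq f_HB)

lemma mem_span_words_X0: "b \<in> HB \<Longrightarrow> b \<in> span (P ` lists X0)"
proof -
  have "insert 1 (f ` {y \<in> Os. t y = 0}) \<subseteq> P ` lists X0"
  proof -
    have "P [] \<in> P ` lists X0" by (rule imageI) simp
    moreover have "P [Plain y] \<in> P ` lists X0" if "y \<in> Os" "t y = 0" for y
      using that by (intro imageI) (auto simp: X0_eq)
    ultimately show ?thesis by auto
  qed
  then show "b \<in> span (P ` lists X0)" if "b \<in> HB" using HB_span[OF that] span_mono by blast
qed

text \<open>That the Hopf coradical is a subcoalgebra is read off from skew-triangularity on the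
  letters of degree zero, whose words span it.\<close>

lemma comult_HB:
  assumes "b \<in> HB"
  shows "comult b \<in> tensor_sub scale scale HB HB"
proof (rule comult_span[OF mem_span_words_X0[OF assms]], clarify)
  fix w assume "\<forall>x\<in>set w. x \<in> X0"
  then have w: "w \<in> lists X0" by auto
  then have "w \<in> lists X" using X0_X by auto
  then show "comult (P w) \<in> tensor_sub scale scale HB HB"
    using keys_\<Delta>_word[OF X0_X keys_\<Delta>_X0_letter w] P_mem_HB by (intro comult_P_mem) auto
qed

lemma antipode_HB: "b \<in> HB \<Longrightarrow> antipode b \<in> HB"
  using antipode_hopf_coradical by blast

definition right_module_span :: "'h set \<Rightarrow> 'h set" where
  "right_module_span S = span {x * b | x b. x \<in> S \<and> b \<in> HB}"

lemma right_module_span_mult: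
  assumes "x \<in> right_module_span S" "b \<in> HB"
  shows "x * b \<in> right_module_span S"
proof -
  have "b \<in> span {b}" by (simp add: span_base)
  with assms(1) show ?thesis
    unfolding right_module_span_def
  proof (rule span_mult)
    fix a b' assume "a \<in> {x * b |x b. x \<in> S \<and> b \<in> HB}" "b' \<in> {b}"
    then show "a * b' \<in> span {x * b |x b. x \<in> S \<and> b \<in> HB}"
      using assms(2) HB_simps(3) by (intro span_base) (auto simp: mult.assoc, blast)
  qed (rule subspace_span)
qed

lemma subspace_right_module_span: "subspace (right_module_span S)"
  unfolding right_module_span_def by (rule subspace_span)

text \<open>By \<open>mult_eq_ad\<close> it suffices that \<open>ad c (f z)\<close> is a combination
  of letters of the class \<open>z\<close> for \<open>c\<close> in the Hopf coradical. This holds on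
  a spanning set: \<open>c = 1\<close> gives \<open>z\<close>, and \<open>c = f a\<close> gives the
  symbol \<open>Sub z a\<close>.\<close>

lemma HB_mult_f:
  assumes z: "z \<in> Os" "t z \<ge> 1" and b: "b \<in> HB"
  shows "b * f z \<in> right_module_span (L ` {y \<in> Xp. C y = z})"
proof -
  obtain T where T: "Poly_Mapping.keys T \<subseteq> HB \<times> HB" "tensor_eq scale scale (comult b) T"
    using comult_HB[OF b] by (auto simp: tensor_sub_def)
  have ad: "ad c (f z) \<in> span (L ` {y \<in> Xp. C y = z})" if "c \<in> HB" for c
    using HB_span[OF that]
  proof (induction rule: span_induct_alt)
    case base
    show ?case using ad_scale[of 0 0] by (simp add: span_zero)
  next
    case (step k x y)
    have "ad x (f z) \<in> L ` {y \<in> Xp. C y = z}"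
    proof (cases "x = 1")
      case True
      have "Plain z \<in> {y \<in> Xp. C y = z}"
        using z by (simp add: letters_plus_def letters_def)
      then show ?thesis using True by (auto simp: ad_one intro!: image_eqI[of _ _ "Plain z"])
    next
      case False
      with step(1) obtain a where a: "a \<in> Os" "t a = 0" "x = f a" by auto
      then have "Sub z a \<in> {y \<in> Xp. C y = z}"
        using z by (simp add: letters_plus_def letters_def)
      then show ?thesis using a by (auto simp: ad_def intro!: image_eqI[of _ _ "Sub z a"])
    qed
    then show ?case using step(2) by (auto simp: ad_add ad_scale intro: span_add span_scale span_base)
  qed
  have "b * f z = lin_ext scale (\<lambda>(u, v). ad u (f z) * v) T"
    unfolding mult_eq_ad[of b "f z"]
    by (rule lin_ext_tensor_eq[OF vector_space_axioms bilinear_ad_mult T(2)])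
  also have "\<dots> \<in> right_module_span (L ` {y \<in> Xp. C y = z})"
  proof (rule lin_ext_mem[OF subspace_right_module_span], clarify)
    fix c d assume "(c, d) \<in> Poly_Mapping.keys T"
    with T have cd: "c \<in> HB" "d \<in> HB" by auto
    have "d \<in> span {d}" by (simp add: span_base)
    with ad[OF cd(1)] show "ad c (f z) * d \<in> right_module_span (L ` {y \<in> Xp. C y = z})"
    proof (rule span_mult)
      show "a * d' \<in> right_module_span (L ` {y \<in> Xp. C y = z})" if "a \<in> L ` {y \<in> Xp. C y = z}" "d' \<in> {d}" for a d'
        unfolding right_module_span_def using that cd(2) by (intro span_base) blast
    qed (rule subspace_right_module_span)
  qed
  finally show ?thesis .
qed

text \<open>The defining sum of the symbol has factors from the Hopf coradical on both sides of
  \<open>f z\<close>, as the coradical is closed under coproduct and antipode. So the letter lies in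
  the sub-bimodule generated by \<open>f z\<close>.\<close>

lemma L_Sub_mem:
  assumes a: "a \<in> Os" "t a = 0" and V: "subspace V" "\<And>b b'. b \<in> HB \<Longrightarrow> b' \<in> HB \<Longrightarrow> b * f z * b' \<in> V"
  shows "L (Sub z a) \<in> V"
proof -
  obtain T where T: "Poly_Mapping.keys T \<subseteq> HB \<times> HB" "tensor_eq scale scale (comult (f a)) T"
    using comult_HB[OF f_HB[OF a]] by (auto simp: tensor_sub_def)
  have "L (Sub z a) = lin_ext scale (\<lambda>(u, v). u * f z * antipode v) T"
    using lin_ext_tensor_eq[OF vector_space_axioms bilinear_ad T(2)] by simp
  also have "\<dots> \<in> V"
    using T(1) antipode_HB by (intro lin_ext_mem[OF V(1)]) (auto intro!: V(2))
  finally show ?thesis .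
qed

text \<open>Every letter of the class lies in the bimodule generated by \<open>f z\<close>, and
  \<open>HB_mult_f\<close> places that bimodule in the right module spanned by the class.\<close>

lemma HB_mult_L:
  assumes y: "y \<in> Xp" and b: "b \<in> HB"
  shows "b * L y \<in> right_module_span (L ` {y' \<in> Xp. C y' = C y})"
proof (cases y)
  case (Plain z)
  then show ?thesis using HB_mult_f[of z b] y b by (auto simp: letters_plus_def letters_def)
next
  case (Sub z a)
  then have za: "z \<in> Os" "t z \<ge> 1" "a \<in> Os" "t a = 0"
    using y by (auto simp: letters_plus_def letters_def)
  let ?V = "right_module_span (L ` {y' \<in> Xp. C y' = z})"
  have "subspace {h. b * h \<in> ?V}"
    using subspace_right_module_span[of "L ` {y' \<in> Xp. C y' = z}"]
    by (auto simp: subspace_def algebra_rules)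
  then have "L (Sub z a) \<in> {h. b * h \<in> ?V}"
  proof (rule L_Sub_mem[OF za(3,4)])
    fix c c' assume c: "c \<in> HB" "c' \<in> HB"
    have "(b * c) * f z * c' \<in> ?V"
      by (intro right_module_span_mult HB_mult_f za HB_simps b c)
    then show "c * f z * c' \<in> {h. b * h \<in> ?V}" by (simp add: mult.assoc)
  qed
  then show ?thesis using Sub by simp
qed

text \<open>The weight is exact: moving an element of the Hopf coradical to the right replaces a
  letter only by letters of the same class, hence of the same degree.\<close>

definition normal_span :: "nat \<Rightarrow> 'h set" where
  "normal_span n = right_module_span (P ` {w \<in> lists Xp. weight t w = n})"

lemma L_mult_normal_span:
  assumes y: "y \<in> Xp" and x: "x \<in> normal_span n"
  shows "L y * x \<in> normal_span (t (C y) + n)"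
proof -
  have "L y \<in> span {L y}" by (simp add: span_base)
  then show ?thesis
    using x unfolding normal_span_def right_module_span_def[of "P ` {w \<in> lists Xp. weight t w = n}"]
  proof (rule span_mult)
    fix a b assume "a \<in> {L y}" "b \<in> {x * b |x b. x \<in> P ` {w \<in> lists Xp. weight t w = n} \<and> b \<in> HB}"
    then obtain w c where "a = L y" "b = P w * c" "w \<in> lists Xp" "weight t w = n" "c \<in> HB" by blast
    then have "a * b = P (y # w) * c" "y # w \<in> {w \<in> lists Xp. weight t w = t (C y) + n}" "c \<in> HB"
      using y by (auto simp: mult.assoc)
    then show "a * b \<in> right_module_span (P ` {w \<in> lists Xp. weight t w = t (C y) + n})"
      unfolding right_module_span_def by (intro span_base) blast
  qed (rule subspace_right_module_span)
qed

lemma HB_mult_P: "w \<in> lists Xp \<Longrightarrow> b \<in> HB \<Longrightarrow> b * P w \<in> normal_span (weight t w)"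
proof (induction w arbitrary: b)
  case Nil
  have "[] \<in> {w \<in> lists Xp. weight t w = 0}" by simp
  then have "P [] * b \<in> normal_span 0"
    using Nil(2) unfolding normal_span_def right_module_span_def by (intro span_base) blast
  then show ?case by simp
next
  case (Cons y w)
  then have yw: "y \<in> Xp" "w \<in> lists Xp" by auto
  have "P w \<in> span {P w}" by (simp add: span_base)
  with HB_mult_L[OF yw(1) Cons(3), unfolded right_module_span_def]
  have "(b * L y) * P w \<in> normal_span (weight t (y # w))"
  proof (rule span_mult)
    fix a p assume "a \<in> {x * b |x b. x \<in> L ` {y' \<in> Xp. C y' = C y} \<and> b \<in> HB}" "p \<in> {P w}"
    then obtain y' c where *: "a = L y' * c" "p = P w" "y' \<in> Xp" "C y' = C y" "c \<in> HB" by blast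
    have "L y' * (c * P w) \<in> normal_span (t (C y') + weight t w)"
      by (intro L_mult_normal_span Cons.IH * yw)
    then show "a * p \<in> normal_span (weight t (y # w))" using * by (simp add: mult.assoc)
  qed (simp add: normal_span_def subspace_right_module_span)
  then show ?case by (simp add: mult.assoc)
qed

lemma P_normal_span: "w \<in> lists X \<Longrightarrow> P w \<in> normal_span (weight t w)"
proof (induction w)
  case Nil
  then show ?case using HB_mult_P[of "[]" 1] HB_simps by simp
next
  case (Cons x w)
  then have IH: "P w \<in> normal_span (weight t w)" by auto
  show ?case
  proof (cases "x \<in> Xp")
    case True
    then show ?thesis using L_mult_normal_span[OF True IH] by simp
  next
    case False
    with Cons(2) have x: "x \<in> X0" using X_split by auto
    then have Lx: "L x \<in> HB" "t (C x) = 0" by (auto simp: X0_eq f_HB)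
    have "L x \<in> span {L x}" by (simp add: span_base)
    then have "L x * P w \<in> normal_span (weight t w)"
      using IH[unfolded normal_span_def right_module_span_def]
    proof (rule span_mult)
      fix a p assume "a \<in> {L x}" "p \<in> {x * b |x b. x \<in> P ` {w' \<in> lists Xp. weight t w' = weight t w} \<and> b \<in> HB}"
      then obtain w' b where *: "a = L x" "p = P w' * b" "w' \<in> lists Xp" "weight t w' = weight t w" "b \<in> HB" by blast
      have "L x * P w' \<in> normal_span (weight t w)"
        using HB_mult_P[OF *(3) Lx(1)] *(4) by simp
      then have "(L x * P w') * b \<in> normal_span (weight t w)"
        unfolding normal_span_def by (rule right_module_span_mult) (fact *)
      then show "a * p \<in> normal_span (weight t w)"
        using * by (simp add: mult.assoc)
    qed (simp add: normal_span_def subspace_right_module_span)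
    with Lx show ?thesis by simp
  qed
qed

lemma subalgebra_words: "subalgebra scale (span (P ` lists Z))"
  unfolding subalgebra_def
proof (intro conjI ballI)
  have "P [] \<in> P ` lists Z" by (rule imageI) simp
  then show "1 \<in> span (P ` lists Z)" by (intro span_base) simp
  fix x y assume "x \<in> span (P ` lists Z)" "y \<in> span (P ` lists Z)"
  then show "x * y \<in> span (P ` lists Z)"
  proof (rule span_mult)
    fix a b assume "a \<in> P ` lists Z" "b \<in> P ` lists Z"
    then obtain u v where "a = P u" "b = P v" "u @ v \<in> lists Z" by fastforce
    then have "a * b = P (u @ v)" by simp
    then show "a * b \<in> span (P ` lists Z)" using \<open>u @ v \<in> lists Z\<close> by (simp only: span_base imageI)
  qed (rule subspace_span)
qed (rule subspace_span)

lemma UNIV_span_P: "h \<in> span (P ` lists X)"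
proof -
  have "f ` Os \<subseteq> span (P ` lists X)"
  proof clarify
    fix y assume "y \<in> Os"
    then have "[Plain y] \<in> lists X" by (simp add: letters_def)
    then have "P [Plain y] \<in> span (P ` lists X)" by (intro span_base imageI)
    then show "f y \<in> span (P ` lists X)" by simp
  qed
  then have "subalgebra scale hull (f ` Os) \<subseteq> span (P ` lists X)"
    using subalgebra_words by (rule hull_minimal)
  with generates show ?thesis by auto
qed

abbreviation "NF n \<equiv> span {P w * b | w b. w \<in> lists Xp \<and> weight t w < n \<and> b \<in> HB}"

lemma normal_span_NF: "m < n \<Longrightarrow> normal_span m \<subseteq> NF n"
  unfolding normal_span_def right_module_span_def by (rule span_mono) blast

sublocale filtered_hopf_algebra scale comult counit antipode HB "lists Xp" P "weight t"
proof
  show "subalgebra scale HB" by (rule subalgebra_HB)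
  show "antipode b \<in> HB" if "b \<in> HB" for b using that by (rule antipode_HB)
  show "comult b \<in> tensor_sub scale scale HB HB" if "b \<in> HB" for b using that by (rule comult_HB)
  show "hit \<chi> (P w) - scale (\<chi> 1) (P w) \<in> NF (weight t w)" if w: "w \<in> lists Xp" and \<chi>: "functional \<chi>" for w \<chi>
  proof -
    have wX: "w \<in> lists X" using w Xp_X by auto
    let ?g = "\<lambda>(u, v). scale (\<chi> (P v)) (P u)"
    have "hit \<chi> (P w) - scale (\<chi> 1) (P w) =
        lin_ext scale ?g (\<Delta> (Poly_Mapping.single w 1) - Poly_Mapping.single (w, []) 1)"
      unfolding hit_P_eq[OF \<chi> wX] lin_ext_diff[OF vector_space_axioms]
      by (simp add: lin_ext_simps)
    also have "\<dots> \<in> NF (weight t w)"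
    proof (rule lin_ext_mem[OF subspace_span], clarify)
      fix u v assume "(u, v) \<in> Poly_Mapping.keys (\<Delta> (Poly_Mapping.single w 1) - Poly_Mapping.single (w, []) 1)"
      then have "u \<in> lists X" "weight t u < weight t w"
        using keys_\<Delta>_weight[OF w] by auto
      \<comment> \<open>The left factor \<open>u\<close> may contain letters of degree zero
        anywhere; passing to normal form moves them to the right without changing the
        weight.\<close>
      then have "P u \<in> NF (weight t w)" using P_normal_span normal_span_NF by blast
      then show "scale (\<chi> (P v)) (P u) \<in> NF (weight t w)" by (rule span_scale)
    qed
    finally show ?thesis .
  qed
  show "\<exists>n. h \<in> NF n" for h
    using UNIV_span_P[of h]
  proof (induction rule: span_induct_alt)
    case base
    show ?case by (auto intro: span_zero)
  next
    case (step c x y)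
    then obtain w n where *: "x = P w" "w \<in> lists X" "y \<in> NF n" by auto
    have "normal_span (weight t w) \<subseteq> NF (max n (Suc (weight t w)))"
      by (rule normal_span_NF) simp
    then have "x \<in> NF (max n (Suc (weight t w)))"
      using P_normal_span[OF *(2)] * by auto
    moreover have "NF n \<subseteq> NF (max n (Suc (weight t w)))"
      by (rule span_mono) force
    ultimately show ?case using * by (intro exI[of _ "max n (Suc (weight t w))"] span_add span_scale) auto
  qed
qed

end

section \<open>Reducible letters\<close>

context hopf_framework
begin

definition below :: "'o \<Rightarrow> 'o letter set" where
  "below z = {y \<in> X. lt (C y) z}"

definition A :: "'o \<Rightarrow> 'h set" where
  "A z = span (P ` lists (below z))"

lemma X0_below: "t z \<ge> 1 \<Longrightarrow> X0 \<subseteq> below z"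
  by (auto simp: below_def letters0_def less_O_def)

text \<open>Left tensor factors of a letter involve only the letter itself, lower classes and degree
  zero, all below \<open>z\<close>. Right factors are not confined in this way, so the resulting
  subalgebra is a right coideal but need not be a subcoalgebra.\<close>

lemma below_letter:
  assumes z: "t z \<ge> 1" and y: "y \<in> below z"
  shows "Poly_Mapping.keys (\<Delta> (Poly_Mapping.single [y] 1)) \<subseteq> lists (below z) \<times> lists X"
proof (cases "y \<in> X0")
  case True
  then show ?thesis using keys_\<Delta>_X0_letter[OF True] X0_X lists_mono[OF X0_below[OF z]] by blast
next
  case False
  then have yp: "y \<in> Xp" and yX: "y \<in> X" "lt (C y) z" using y X_split by (auto simp: below_def)
  obtain R where R: "\<Delta> (Poly_Mapping.single [y] 1) =
      Poly_Mapping.single ([y], []) 1 + Poly_Mapping.single ([], [y]) 1 + R"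
    "Poly_Mapping.keys R \<subseteq> {u \<in> lists X. weight t u < t (C y) \<and> (\<forall>x\<in>set u. lt (C x) (C y))} \<times> lists X"
    by (rule \<Delta>_Xp_letter[OF yp])
  have "{u \<in> lists X. weight t u < t (C y) \<and> (\<forall>x\<in>set u. lt (C x) (C y))} \<subseteq> lists (below z)"
    using less_O_trans[OF ord _ yX(2)] by (auto simp: below_def)
  then have "Poly_Mapping.keys R \<subseteq> lists (below z) \<times> lists X"
    using R(2) by blast
  then show ?thesis
    unfolding R(1) using y yX(1)
    by (intro order_trans[OF keys_add] Un_least) auto
qed


lemma coideal_subalgebra_A:
  assumes "t z \<ge> 1"
  shows "coideal_subalgebra scale comult counit antipode HB (lists Xp) P (weight t) (A z)"
proof unfold_locales
  have below_X: "below z \<subseteq> X" by (auto simp: below_def)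
  show "subalgebra scale (A z)"
    unfolding A_def by (rule subalgebra_words)
  show "comult a \<in> tensor_sub scale scale (A z) UNIV" if "a \<in> A z" for a
    using that unfolding A_def
  proof (rule comult_span, clarify)
    fix w assume "\<forall>x\<in>set w. x \<in> below z"
    then have w: "w \<in> lists (below z)" by auto
    then have "w \<in> lists X" using below_X by auto
    then show "comult (P w) \<in> tensor_sub scale scale (span (P ` lists (below z))) UNIV"
      using keys_\<Delta>_word[OF below_X below_letter[OF assms] w] span_superset[of "P ` lists (below z)"]
      by (intro comult_P_mem[of w "lists (below z)" "lists X"]) blast+
  qed
  have "P ` lists X0 \<subseteq> P ` lists (below z)"
    by (intro image_mono lists_mono X0_below assms)
  then show "HB \<subseteq> A z"
    unfolding A_def using mem_span_words_X0 span_mono by blast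
qed

lemma counit_L:
  assumes "x \<in> X"
  shows "counit (L x) = 0"
proof (cases x)
  case (Plain y)
  then show ?thesis using assms counit_f by (auto simp: letters_def)
next
  case (Sub y a)
  then have "counit (f y) = 0" using assms counit_f by (auto simp: letters_def)
  then show ?thesis
    using Sub functional_counit
    by (simp add: lin_ext_def functional_sum[OF functional_counit])
      (simp add: functional_def split_def counit_mult)
qed

lemma counit_P: "w \<in> lists X \<Longrightarrow> w \<noteq> [] \<Longrightarrow> counit (P w) = 0"
  by (cases w) (auto simp: counit_mult counit_L)

text \<open>Apart from \<open>y \<otimes> 1\<close>, all summands of the coproduct of
  \<open>y\<close> have their left factor equal to 1 or built from letters of lower class.\<close>

lemma coinvariant_mod_letter:
  assumes y: "y \<in> Xp"
  shows "coinvariant_mod (A (C y)) (L y)"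
  unfolding coinvariant_mod_def
proof (intro allI impI)
  fix \<chi> assume \<chi>: "functional \<chi>"
  obtain R where R: "\<Delta> (Poly_Mapping.single [y] 1) =
      Poly_Mapping.single ([y], []) 1 + Poly_Mapping.single ([], [y]) 1 + R"
    "Poly_Mapping.keys R \<subseteq> {u \<in> lists X. weight t u < t (C y) \<and> (\<forall>x\<in>set u. lt (C x) (C y))} \<times> lists X"
    by (rule \<Delta>_Xp_letter[OF y])
  have yX: "[y] \<in> lists X" using y Xp_X by auto
  have mem: "P u \<in> A (C y)" if "u \<in> lists X" "\<forall>x\<in>set u. lt (C x) (C y)" for u
    unfolding A_def using that by (intro span_base imageI) (auto simp: below_def)
  have "hit \<chi> (L y) - scale (\<chi> 1) (L y) =
      scale (\<chi> (L y)) (P []) + lin_ext scale (\<lambda>(u, v). scale (\<chi> (P v)) (P u)) R"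
    using hit_P_eq[OF \<chi> yX] by (simp add: R(1) lin_ext_simps)
  also have "\<dots> \<in> A (C y)"
  proof -
    have sub: "subspace (A (C y))" unfolding A_def by (rule subspace_span)
    have "(case x of (u, v) \<Rightarrow> scale (\<chi> (P v)) (P u)) \<in> A (C y)" if "x \<in> Poly_Mapping.keys R" for x
      using that R(2) by (auto intro!: subspace_scale[OF sub] mem)
    then have "lin_ext scale (\<lambda>(u, v). scale (\<chi> (P v)) (P u)) R \<in> A (C y)"
      by (rule lin_ext_mem[OF sub])
    moreover have "P [] \<in> A (C y)" by (rule mem) auto
    ultimately show ?thesis using sub by (intro subspace_add subspace_scale)
  qed
  finally show "hit \<chi> (L y) - scale (\<chi> 1) (L y) \<in> A (C y)" .
qed

lemma coinvariant_mod_sum: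
  assumes N: "subspace N" and "\<And>i. i \<in> S \<Longrightarrow> coinvariant_mod N (g i)"
  shows "coinvariant_mod N (\<Sum>i\<in>S. scale (c i) (g i))"
  unfolding coinvariant_mod_def
proof (intro allI impI)
  fix \<chi> assume \<chi>: "functional \<chi>"
  have lin: "module_hom scale scale (hit \<chi>)"
    using linear_hit[OF \<chi>] by (simp add: module_hom_eq_linear)
  have "hit \<chi> (\<Sum>i\<in>S. scale (c i) (g i)) - scale (\<chi> 1) (\<Sum>i\<in>S. scale (c i) (g i)) =
      (\<Sum>i\<in>S. scale (c i) (hit \<chi> (g i) - scale (\<chi> 1) (g i)))"
    by (simp add: module_hom.sum[OF lin] module_hom.scale[OF lin] scale_sum_right sum_subtractf
        scale_right_diff_distrib mult.commute)
  also have "\<dots> \<in> N"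
    using assms \<chi> by (intro subspace_sum subspace_scale) (auto simp: coinvariant_mod_def)
  finally show "hit \<chi> (\<Sum>i\<in>S. scale (c i) (g i)) - scale (\<chi> 1) (\<Sum>i\<in>S. scale (c i) (g i)) \<in> N" .
qed

definition relations :: "('o letter list \<Rightarrow>\<^sub>0 'k) set" where
  "relations = {p \<in> free_algebra X. free_alg_hom scale L p = 0}"

text \<open>If the last letter has the same class as \<open>x\<close>, the length is compared next.
  A non-empty word cannot be shorter than a single letter, so it is a single letter, and the mirror
  lexicographic comparison decides.\<close>

lemma less_Xw_letter:
  assumes "less_Xw t lt w [x]" "w \<noteq> []"
  shows "lt (C (last w)) (C x) \<or> (\<exists>y. w = [y] \<and> C y = C x \<and> ltX y x)"
proof -
  have O: "\<not> lt a a" for a by (rule less_O_irrefl[OF ord])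
  have single: "w' = [C x]" if "length w' = 1" "last w' = C x" for w'
    using that by (cases w') auto
  have "\<not> mlex lt [C x] [C x]"
    using O by (simp add: mlex_iff_lexord)
  moreover have "ltX y x" if "mlex ltX [y] [x]" for y
    using that by (simp add: mlex_iff_lexord)
  ultimately show ?thesis
    using assms single[of "map C w"] unfolding less_Xw_def less_Ow_def
    by (auto simp: last_map length_Suc_conv)
qed

lemma L_reducible:
  assumes x: "x \<in> Xp" and red: "reducible (less_Xw t lt) relations [x]"
  shows "L x \<in> span (P ` lists {y \<in> X. ltX y x})"
proof -
  define z where "z = C x"
  have z: "t z \<ge> 1" using x by (simp add: z_def letters_plus_def)
  have xX: "x \<in> X" using x Xp_X by auto
  interpret A: coideal_subalgebra scale comult counit antipode HB "lists Xp" P "weight t" "A z"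
    by (rule coideal_subalgebra_A[OF z])
  obtain p where p: "p \<in> relations" "p \<noteq> 0" "[x] = LW (less_Xw t lt) p"
    using red by (auto simp: reducible_def)
  have keys: "Poly_Mapping.keys p \<subseteq> lists X" using p by (auto simp: relations_def free_algebra_def)
  define c where "c = Poly_Mapping.lookup p"
  have xp: "[x] \<in> Poly_Mapping.keys p" "\<And>w. w \<in> Poly_Mapping.keys p \<Longrightarrow> w \<noteq> [x] \<Longrightarrow> less_Xw t lt w [x]"
    using LW_mem[OF strict_linear_on_less_Xw[of Os t ord, OF ord] keys p(2)] p(3) by auto
  \<comment> \<open>\<open>S\<close> contains \<open>[x]\<close> and the other letters of its class
    that occur in the relation; \<open>v\<close> is their contribution, so the relation equates it
    with the negative of all remaining terms.\<close>
  define S where "S = {w \<in> Poly_Mapping.keys p. \<exists>y. w = [y] \<and> C y = z}"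
  have fin: "finite S" by (simp add: S_def)
  define v where "v = (\<Sum>w\<in>S. scale (c w) (P w))"
  have "0 = (\<Sum>w\<in>Poly_Mapping.keys p. scale (c w) (P w))"
    using p(1) by (simp add: relations_def free_alg_hom_eq lin_ext_def c_def)
  also have "\<dots> = v + (\<Sum>w\<in>Poly_Mapping.keys p - S. scale (c w) (P w))"
    unfolding v_def by (subst sum.subset_diff[of S]) (auto simp: S_def)
  finally have v_eq: "v = - (\<Sum>w\<in>Poly_Mapping.keys p - S. scale (c w) (P w))"
    by (simp add: eq_neg_iff_add_eq_0)
  have aug: "P w \<in> A.aug UNIV" if w: "w \<in> Poly_Mapping.keys p - S" for w
  proof (cases "w = []")
    case True
    then show ?thesis using A.one_A by (simp add: A.aug_def span_base)
  next
    case False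
    have "w \<noteq> [x]" using w xp(1) by (auto simp: S_def z_def)
    then have "lt (C (last w)) z"
      using less_Xw_letter[OF xp(2) False] w by (auto simp: S_def z_def)
    moreover have last: "last w \<in> X" using w keys False by (auto simp: in_lists_conv_set)
    ultimately have "[last w] \<in> lists (below z)" by (simp add: below_def)
    then have "P [last w] \<in> A z" unfolding A_def by (intro span_base imageI)
    then have "P (butlast w) * L (last w) \<in> A.aug UNIV"
      unfolding A.aug_def using counit_L[OF last] by (intro span_base) auto
    moreover have "P w = P (butlast w) * P [last w]"
      by (simp only: P_simps(3)[symmetric] append_butlast_last_id[OF False])
    ultimately show ?thesis by simp
  qed
  have "v \<in> A.aug UNIV"
    unfolding v_eq A.aug_def by (intro span_neg span_sum span_scale aug[unfolded A.aug_def])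
  moreover have "coinvariant_mod (A z) v"
    unfolding v_def
  proof (rule coinvariant_mod_sum[OF A.subspace_A])
    fix w assume "w \<in> S"
    then obtain y where y: "w = [y]" "C y = z" "y \<in> X" using keys by (auto simp: S_def)
    then have "y \<in> Xp" using z by (simp add: letters_plus_def)
    then show "coinvariant_mod (A z) (P w)" using coinvariant_mod_letter y by auto
  qed
  ultimately have v: "v \<in> A z" by (rule A.coinvariant_in_aug[rotated])
  \<comment> \<open>All of \<open>A z\<close> is expressed by letters smaller than \<open>x\<close>,
    and so are the other members of \<open>S\<close>. What is left of \<open>v\<close> is a multiple
    of \<open>L x\<close> whose coefficient is nonzero because \<open>[x]\<close> is the leading
    word.\<close>
  have "below z \<subseteq> {y \<in> X. ltX y x}" by (auto simp: below_def less_X_def z_def)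
  then have "v \<in> span (P ` lists {y \<in> X. ltX y x})"
    using v span_mono[OF image_mono[OF lists_mono]] unfolding A_def by blast
  moreover have "(\<Sum>w\<in>S - {[x]}. scale (c w) (P w)) \<in> span (P ` lists {y \<in> X. ltX y x})"
  proof (intro span_sum span_scale span_base imageI)
    fix w assume w: "w \<in> S - {[x]}"
    then obtain y where y: "w = [y]" "C y = z" "y \<in> X" using keys by (auto simp: S_def)
    then have "ltX y x"
      using less_Xw_letter[OF xp(2), of w] w less_O_irrefl[OF ord, of "C x"] by (auto simp: S_def z_def)
    then show "w \<in> lists {y \<in> X. ltX y x}" using y by simp
  qed
  moreover have "v = scale (c [x]) (L x) + (\<Sum>w\<in>S - {[x]}. scale (c w) (P w))"
    unfolding v_def using fin xp(1) by (subst sum.remove[of S "[x]"]) (auto simp: S_def z_def)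
  ultimately have "scale (c [x]) (L x) \<in> span (P ` lists {y \<in> X. ltX y x})"
    using span_diff[of v _ "\<Sum>w\<in>S - {[x]}. scale (c w) (P w)"] by (simp only: add_diff_cancel_right')
  then have "scale (inverse (c [x])) (scale (c [x]) (L x)) \<in> span (P ` lists {y \<in> X. ltX y x})"
    by (rule span_scale)
  moreover have "c [x] \<noteq> 0" using xp(1) by (simp add: c_def in_keys_iff)
  ultimately show ?thesis by simp
qed

section \<open>Rewriting words over irreducible letters\<close>

definition word_span :: "'o letter set \<Rightarrow> 'h set" where
  "word_span Z = span (P ` (lists Z - {[]}))"

lemma subspace_word_span: "subspace (word_span Z)"
  unfolding word_span_def by (rule subspace_span)

lemma word_span_mono: "Z \<subseteq> Z' \<Longrightarrow> word_span Z \<subseteq> word_span Z'"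
  unfolding word_span_def by (intro span_mono image_mono Diff_mono lists_mono) auto

lemma L_word_span: "y \<in> Z \<Longrightarrow> L y \<in> word_span Z"
  unfolding word_span_def by (rule span_base) (auto intro!: image_eqI[of _ _ "[y]"])

lemma word_span_mult:
  assumes "x \<in> word_span Z" "y \<in> word_span Z"
  shows "x * y \<in> word_span Z"
  using assms(1)[unfolded word_span_def] assms(2)[unfolded word_span_def]
proof (rule span_mult)
  fix a b assume "a \<in> P ` (lists Z - {[]})" "b \<in> P ` (lists Z - {[]})"
  then obtain u v where uv: "a = P u" "b = P v" "u @ v \<in> lists Z - {[]}" by fastforce
  have "P (u @ v) \<in> word_span Z" unfolding word_span_def by (intro span_base imageI uv)
  then show "a * b \<in> word_span Z" using uv by simp
qed (rule subspace_word_span)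

lemma P_word_span:
  assumes "\<And>y. y \<in> Z \<Longrightarrow> L y \<in> word_span Z'"
  shows "w \<in> lists Z \<Longrightarrow> w \<noteq> [] \<Longrightarrow> P w \<in> word_span Z'"
proof (induction w)
  case (Cons y w)
  then show ?case using assms by (cases "w = []") (auto intro: word_span_mult)
qed simp

lemma word_span_subst:
  assumes "\<And>y. y \<in> Z \<Longrightarrow> L y \<in> word_span Z'"
  shows "word_span Z \<subseteq> word_span Z'"
proof -
  have "P ` (lists Z - {[]}) \<subseteq> word_span Z'"
    using P_word_span[of Z Z'] assms by blast
  then show ?thesis
    unfolding word_span_def[of Z] by (rule span_minimal[OF _ subspace_word_span])
qed

text \<open>The counit vanishes on non-empty words, so it detects the coefficient of the empty word.
  This removes the constant term that \<open>L_reducible\<close> leaves open.\<close>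

lemma mem_word_span_if_counit:
  assumes h: "h \<in> span (P ` lists Z)" "counit h = 0" and Z: "Z \<subseteq> X"
  shows "h \<in> word_span Z"
proof -
  have "lists Z = insert [] (lists Z - {[]})" by auto
  then have "P ` lists Z = insert 1 (P ` (lists Z - {[]}))"
    by (metis P_simps(1) image_insert)
  then obtain k where k: "h - scale k 1 \<in> word_span Z"
    using h(1) by (auto simp: span_insert word_span_def)
  have "counit g = 0" if "g \<in> word_span Z" for g
    using that unfolding word_span_def
  proof (induction rule: span_induct_alt)
    case base
    show ?case by (rule functional_zero[OF functional_counit])
  next
    case (step c g g')
    then obtain w where "g = P w" "w \<in> lists X" "w \<noteq> []" using Z by blast
    then show ?case using step(2) counit_P functional_counit by (simp add: functional_def)
  qed
  from this[OF k] have "counit h = counit (scale k 1)"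
    using functional_counit unfolding functional_def
    by (metis add.left_neutral diff_add_cancel)
  then have "k = 0" using h(2) functional_counit by (simp add: functional_def counit_one)
  with k show ?thesis by simp
qed

abbreviation irreducible_plus :: "'o letter set" where
  "irreducible_plus \<equiv> {x \<in> Xp. \<not> reducible (less_Xw t lt) relations [x]}"

lemma reducible_letter_word_span:
  assumes "x \<in> Xp" "reducible (less_Xw t lt) relations [x]"
  shows "L x \<in> word_span {y \<in> X. ltX y x}"
proof -
  have "x \<in> X" using assms Xp_X by auto
  then show ?thesis
    by (intro mem_word_span_if_counit L_reducible assms counit_L) auto
qed

text \<open>Reducible letters that appear on the right are smaller than \<open>x\<close> and can be
  rewritten by well-founded induction; transitivity keeps all new letters below
  \<open>x\<close>.\<close>

theorem reducible_letter:
  assumes "x \<in> Xp" "reducible (less_Xw t lt) relations [x]"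
  shows "L x \<in> word_span {y \<in> irreducible_plus \<union> X0. ltX y x}"
  using assms
proof (induction x rule: wf_induct_rule[OF wf_less_X[of Os t ord, OF ord]])
  case (1 x)
  have "L y \<in> word_span {y \<in> irreducible_plus \<union> X0. ltX y x}" if y: "y \<in> X" "ltX y x" for y
  proof (cases "y \<in> irreducible_plus \<union> X0")
    case True
    then show ?thesis using y by (intro L_word_span) blast
  next
    case False
    then have "L y \<in> word_span {y' \<in> irreducible_plus \<union> X0. ltX y' y}"
      using y X_split by (intro 1(1)) auto
    moreover have "{y' \<in> irreducible_plus \<union> X0. ltX y' y} \<subseteq> {y \<in> irreducible_plus \<union> X0. ltX y x}"
      using less_X_trans[OF ord _ y(2)] by blast
    ultimately show ?thesis using word_span_mono by blast
  qed
  then have "word_span {y \<in> X. ltX y x} \<subseteq> word_span {y \<in> irreducible_plus \<union> X0. ltX y x}"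
    by (intro word_span_subst) blast
  with reducible_letter_word_span[OF 1(2,3)] show ?case by blast
qed

theorem letter_irreducible_plus:
  assumes "x \<in> X"
  shows "L x \<in> word_span (irreducible_plus \<union> X0)"
proof (cases "x \<in> irreducible_plus \<union> X0")
  case True
  then show ?thesis by (rule L_word_span)
next
  case False
  then have "L x \<in> word_span {y \<in> irreducible_plus \<union> X0. ltX y x}"
    using assms X_split by (intro reducible_letter) auto
  then show ?thesis using word_span_mono[of "{y \<in> irreducible_plus \<union> X0. ltX y x}"] by blast
qed

text \<open>A symbol \<open>Sub y a\<close> is eliminated whether or not it is reducible: it lies in
  the bimodule over the Hopf coradical generated by \<open>f y\<close>, and \<open>Plain y\<close>
  precedes it. A reducible plain letter is rewritten through smaller letters.\<close>

theorem letter_irreducible_plain: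
  assumes "x \<in> X"
  shows "L x \<in> word_span (irreducible_plus \<inter> Plain ` Os \<union> X0)"
  using assms
proof (induction x rule: wf_induct_rule[OF wf_less_X[of Os t ord, OF ord]])
  case (1 x)
  let ?Z = "irreducible_plus \<inter> Plain ` Os \<union> X0"
  show ?case
  proof (cases x)
    case (Plain y)
    show ?thesis
    proof (cases "x \<in> ?Z")
      case False
      then have "x \<in> Xp" "reducible (less_Xw t lt) relations [x]"
        using 1(2) X_split Plain by (auto simp: letters_def)
      moreover have "word_span {y \<in> X. ltX y x} \<subseteq> word_span ?Z"
        by (intro word_span_subst 1(1)) auto
      ultimately show ?thesis using reducible_letter_word_span by blast
    qed (rule L_word_span)
  next
    case (Sub y a)
    then have y: "y \<in> Os" "t y \<ge> 1" "a \<in> Os" "t a = 0" using 1(2) by (auto simp: letters_def)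
    have "ltX (Plain y) x" "Plain y \<in> X" using Sub y by (auto simp: less_X_def letters_def)
    from 1(1)[OF _ this(2)] this(1) have fy: "f y \<in> word_span ?Z" by simp
    \<comment> \<open>Elements of the Hopf coradical may have a constant term, but multiplying by
      \<open>g\<close>, a combination of non-empty words, cannot produce the empty word.\<close>
    have HB: "b * g \<in> word_span ?Z" "g * b \<in> word_span ?Z" if "b \<in> HB" "g \<in> word_span ?Z" for b g
    proof -
      have b: "b \<in> span (P ` lists X0)" using mem_span_words_X0[OF that(1)] .
      have P: "P w * g \<in> word_span ?Z \<and> g * P w \<in> word_span ?Z" if "w \<in> lists X0" for w
      proof (cases "w = []")
        case False
        then have "P w \<in> word_span ?Z"
          using that by (intro P_word_span[of X0] L_word_span) auto
        then show ?thesis using \<open>g \<in> _\<close> by (simp add: word_span_mult)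
      qed (use \<open>g \<in> _\<close> in simp)
      have g: "g \<in> span {g}" by (simp add: span_base)
      show "b * g \<in> word_span ?Z"
        by (rule span_mult[OF b g _ subspace_word_span]) (use P in auto)
      show "g * b \<in> word_span ?Z"
        by (rule span_mult[OF g b _ subspace_word_span]) (use P in auto)
    qed
    have "L (Sub y a) \<in> word_span ?Z"
      by (rule L_Sub_mem[OF y(3,4) subspace_word_span]) (intro HB fy)
    then show ?thesis using Sub by simp
  qed
qed

text \<open>Returns from \<open>H\<close> to the free algebra: a preimage \<open>p\<close> of
  \<open>P w\<close> supported on words over \<open>Z\<close> differs from \<open>w\<close> by an
  element of the kernel.\<close>

lemma word_span_relations:
  assumes "P w \<in> word_span Z" "w \<in> lists X" "Z \<subseteq> X"
  shows "\<exists>p. (\<forall>v\<in>Poly_Mapping.keys p. v \<noteq> [] \<and> set v \<subseteq> Z) \<and> Poly_Mapping.single w 1 - p \<in> relations"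
proof -
  have "\<exists>p. Poly_Mapping.keys p \<subseteq> lists Z - {[]} \<and> lin_ext scale P p = h" if "h \<in> word_span Z" for h
    using that unfolding word_span_def
  proof (induction rule: span_induct_alt)
    case base
    show ?case by (intro exI[of _ 0]) (simp add: lin_ext_def)
  next
    case (step c g h)
    then obtain p v where *: "Poly_Mapping.keys p \<subseteq> lists Z - {[]}" "lin_ext scale P p = h"
      "g = P v" "v \<in> lists Z - {[]}" by blast
    have "Poly_Mapping.keys (Poly_Mapping.single v c + p) \<subseteq> lists Z - {[]}"
      using * by (intro order_trans[OF keys_add] Un_least) auto
    with * show ?case
      by (intro exI[of _ "Poly_Mapping.single v c + p"]) (simp add: lin_ext_simps)
  qed
  from this[OF assms(1)] obtain p where p: "Poly_Mapping.keys p \<subseteq> lists Z - {[]}" "lin_ext scale P p = P w"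
    by blast
  have "Poly_Mapping.single w 1 - p \<in> relations"
    unfolding relations_def free_alg_hom_eq
  proof (intro CollectI conjI)
    have "lists Z \<subseteq> lists X" by (rule lists_mono[OF assms(3)])
    then show "Poly_Mapping.single w 1 - p \<in> free_algebra X"
      unfolding free_algebra_def using p(1) assms(2)
      by (intro CollectI order_trans[OF keys_diff]) auto
    show "lin_ext scale P (Poly_Mapping.single w 1 - p) = 0"
      by (simp add: lin_ext_diff[OF vector_space_axioms] lin_ext_simps p(2))
  qed
  with p(1) show ?thesis by (intro exI[of _ p]) auto
qed

end

theorem theorem5p5:
  fixes scale :: "'k::field \<Rightarrow> 'h::ring_1 \<Rightarrow> 'h"
    and comult :: "'h \<Rightarrow> ('h \<times> 'h \<Rightarrow>\<^sub>0 'k)"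
    and counit :: "'h \<Rightarrow> 'k"
    and antipode :: "'h \<Rightarrow> 'h"
    and Os :: "'o set"
    and t :: "'o \<Rightarrow> nat"
    and ord :: "nat \<Rightarrow> 'o rel"
    and f :: "'o \<Rightarrow> 'h"
    and \<Delta> :: "('o letter list \<Rightarrow>\<^sub>0 'k) \<Rightarrow> ('o letter list \<times> 'o letter list \<Rightarrow>\<^sub>0 'k)"
    and \<pi> :: "('o letter list \<Rightarrow>\<^sub>0 'k) \<Rightarrow> 'h"
    and I :: "('o letter list \<Rightarrow>\<^sub>0 'k) set"
    and ltX :: "'o letter \<Rightarrow> 'o letter \<Rightarrow> bool"
    and ltXw :: "'o letter list \<Rightarrow> 'o letter list \<Rightarrow> bool"
    and X X0 Xp XIp OIp :: "'o letter set"
  assumes "hopf_framework scale comult counit antipode Os t ord f \<Delta>"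
    and "X = letters Os t"
    and "X0 = letters0 Os t"
    and "Xp = letters_plus Os t"
    and "\<pi> = free_alg_hom scale (letter_map scale comult antipode f)"
    and "I = {p \<in> free_algebra X. \<pi> p = 0}"
    and "ltX = less_X t (less_O t ord)"
    and "ltXw = less_Xw t (less_O t ord)"
    and "XIp = {x \<in> Xp. \<not> reducible ltXw I [x]}"
    and "OIp = XIp \<inter> Plain ` Os"
  shows
    "(\<forall>x\<in>Xp. reducible ltXw I [x] \<longrightarrow>
        (\<exists>p. (\<forall>w\<in>Poly_Mapping.keys p. w \<noteq> [] \<and> (\<forall>y\<in>set w. y \<in> XIp \<union> X0 \<and> ltX y x)) \<and>
             Poly_Mapping.single [x] 1 - p \<in> I)) \<and>
     (\<forall>w\<in>lists X. w \<noteq> [] \<longrightarrow>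
        (\<exists>p. (\<forall>v\<in>Poly_Mapping.keys p. v \<noteq> [] \<and> set v \<subseteq> XIp \<union> X0) \<and> Poly_Mapping.single w 1 - p \<in> I)) \<and>
     (\<forall>w\<in>lists X. w \<noteq> [] \<longrightarrow>
        (\<exists>p. (\<forall>v\<in>Poly_Mapping.keys p. v \<noteq> [] \<and> set v \<subseteq> OIp \<union> X0) \<and> Poly_Mapping.single w 1 - p \<in> I))"
proof -
  interpret H: hopf_framework scale comult counit antipode Os t ord f \<Delta>
    by (fact assms(1))
  have I: "I = H.relations"
    unfolding assms(6,5,2) H.relations_def ..
  have XIp: "XIp = H.irreducible_plus"
    unfolding assms(9,4,8) I ..
  have sub: "XIp \<union> X0 \<subseteq> X" "OIp \<union> X0 \<subseteq> X" "Xp \<subseteq> X"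
    using H.X_split unfolding assms(10) XIp assms(2-4) by auto
  show ?thesis
  proof (intro conjI ballI impI)
    fix x assume x: "x \<in> Xp" "reducible ltXw I [x]"
    then have "H.P [x] \<in> H.word_span {y \<in> XIp \<union> X0. ltX y x}"
      using H.reducible_letter[of x] unfolding XIp I assms(3,4,7,8) by simp
    moreover have "[x] \<in> lists H.X" "{y \<in> XIp \<union> X0. ltX y x} \<subseteq> H.X"
      using sub x(1) unfolding assms(2) by auto
    ultimately obtain p where "\<forall>v\<in>Poly_Mapping.keys p. v \<noteq> [] \<and> set v \<subseteq> {y \<in> XIp \<union> X0. ltX y x}"
      "Poly_Mapping.single [x] 1 - p \<in> I"
      using H.word_span_relations unfolding I by meson
    then show "\<exists>p. (\<forall>w\<in>Poly_Mapping.keys p. w \<noteq> [] \<and> (\<forall>y\<in>set w. y \<in> XIp \<union> X0 \<and> ltX y x)) \<and>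
        Poly_Mapping.single [x] 1 - p \<in> I"
      by (intro exI[of _ p]) blast
  next
    fix w assume w: "w \<in> lists X" "w \<noteq> []"
    have "H.P w \<in> H.word_span (XIp \<union> X0)"
      using H.P_word_span[OF H.letter_irreducible_plus _ w(2)] w(1) unfolding XIp assms(2,3) by blast
    then show "\<exists>p. (\<forall>v\<in>Poly_Mapping.keys p. v \<noteq> [] \<and> set v \<subseteq> XIp \<union> X0) \<and> Poly_Mapping.single w 1 - p \<in> I"
      using H.word_span_relations[of w "XIp \<union> X0"] sub(1) w(1) unfolding I assms(2) by blast
  next
    fix w assume w: "w \<in> lists X" "w \<noteq> []"
    have "H.P w \<in> H.word_span (OIp \<union> X0)"
      using H.P_word_span[OF H.letter_irreducible_plain _ w(2)] w(1) unfolding assms(10) XIp assms(2,3) by blast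
    then show "\<exists>p. (\<forall>v\<in>Poly_Mapping.keys p. v \<noteq> [] \<and> set v \<subseteq> OIp \<union> X0) \<and> Poly_Mapping.single w 1 - p \<in> I"
      using H.word_span_relations[of w "OIp \<union> X0"] sub(2) w(1) unfolding I assms(2) by blast
  qed
qed

end
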